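(* Let $\mathcal U_{t,\mathrm{loc}}^+$ be the localized quantum oscillator algebra and $\mathcal A_t$ the quantum cluster algebra with generators $a,a^*,b^{\pm1},c^{\pm1}$, both with scalars extended to $\mathbb C(t)$, as defined in the context, and put $z:=bc^{-1}\in\mathcal A_t$, which is a central element. The map $\varphi:\mathcal U_{t,\mathrm{loc}}^+\to\mathcal A_t$ given on generators by $$e\mapsto z\,a,\qquad f\mapsto a^*,\qquad k^{\pm1}\mapsto\left(-(t-t^{-1})^2b^2\right)^{\pm1},\qquad C^{\pm1}\mapsto z^{\pm1}$$ (on the adjoined square root, $k^{\frac12}\mapsto -i\,(t-t^{-1})\,b$ with $i=\sqrt{-1}$) is an isomorphism of algebras. That is, the localized quantum oscillator algebra is a quantum cluster algebra.
   Context: All algebras are taken with scalars extended to $\mathbb C(t)$, where $t$ is an indeterminate. The quantum oscillator algebra $\mathcal U_t^+(\mathfrak{sl}_2)$ has generators $e,f,k^{\pm1}$ and relations $kk^{-1}=k^{-1}k=1$, $ke=t^2ek$, $kf=t^{-2}fk$, $[e,f]=\frac{k}{t-t^{-1}}$. Its Casimir element is $C=ef+\frac{t^{-1}k}{(t-t^{-1})^2}=fe+\frac{tk}{(t-t^{-1})^2}$, which is central. $\mathcal U_{t,\mathrm{loc}}^+$ denotes $\mathcal U_t^+(\mathfrak{sl}_2)$ localized at $C$ and extended by the square roots $k^{\pm\frac12}$ of $k^{\pm1}$ (with $k^{\frac12}e=t\,e\,k^{\frac12}$ and $k^{\frac12}f=t^{-1}f\,k^{\frac12}$). $\mathcal A_t$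 is the quantum cluster algebra (in the sense of Berenstein–Zelevinsky) whose initial cluster is $\{a,b,c\}$, where $a$ is mutable and $b,c$ are frozen and assumed invertible, with initial ice quiver $c\to a\leftarrow b$. With rows ordered $a,b,c$, its exchange matrix and quantization matrix are $$\tilde B=\begin{pmatrix}0\\1\\1\end{pmatrix},\qquad \Lambda=\begin{pmatrix}0&-1&-1\\1&0&0\\1&0&0\end{pmatrix},$$ where the initial variables $t$-commute by $x_vx_w=t^{\Lambda_{v,w}}x_wx_v$. Let $a^*$ be the cluster variable obtained from $a$ by mutation. Then $\mathcal A_t$ is presented as the algebra with generators $a,a^*,b^{\pm1},c^{\pm1}$ subject to the $t$-commutation relations $$ba=t\,ab,\qquad ca=t\,ac,\qquad bc=cb,$$ the invertibility of $b$ and $c$, and the quantum exchange relations $$aa^*=1+t^{-1}\,bc,\qquad a^*a=1+t\,bc;$$ the $t$-commutations of $a^*$ with the frozen variables are those it has in the quantum torus generated by $a^{\pm1},b^{\pm1},c^{\pm1}$, where $a^*=a^{-1}(1+t^{-1}bc)$, namely $ba^*=t^{-1}a^*b$ and $ca^*=t^{-1}a^*c$. *)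

theory Defs
  imports
    "HOL-Library.Poly_Mapping"
    "HOL-Computational_Algebra.Fraction_Field"
    "HOL-Computational_Algebra.Polynomial"
    "HOL-Algebra.QuotRing"
    "HOL-Algebra.Generated_Rings"
    "HOL-Algebra.Module"
begin

section \<open>Scalars\<close>

type_synonym scalar = "complex poly fract"

definition tt :: scalar where
  "tt = Fraction_Field.Fract [:0, 1:] 1"

definition imag :: scalar where
  "imag = Fraction_Field.Fract [:\<i>:] 1"


section \<open>Algebras given by generators and relations\<close>

text \<open>The free algebra is the monoid algebra of the free monoid of words: \<^type>\<open>poly_mapping\<close>
  carries the convolution product as soon as the exponents form a (possibly noncommutative)
  additive monoid.\<close>

datatype 'g word = Word (letters: "'g list")

instantiation word :: (type) monoid_add
begin

definition zero_word :: "'a word" where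
  "0 = Word []"

definition plus_word :: "'a word \<Rightarrow> 'a word \<Rightarrow> 'a word" where
  "u + v = Word (letters u @ letters v)"

instance
  by standard (auto simp: zero_word_def plus_word_def)

end

type_synonym 'g free_alg = "'g word \<Rightarrow>\<^sub>0 scalar"

definition gen :: "'g \<Rightarrow> 'g free_alg" where
  "gen g = Poly_Mapping.single (Word [g]) 1"

definition scal :: "scalar \<Rightarrow> 'g free_alg" where
  "scal r = Poly_Mapping.single 0 r"

definition free_ring :: "'g free_alg ring" where
  "free_ring = \<lparr>carrier = UNIV, monoid.mult = (*), one = 1, ring.zero = 0, add = (+)\<rparr>"

text \<open>\<^const>\<open>genideal\<close> is the two-sided ideal generated by a set.\<close>

definition cls :: "'g free_alg set \<Rightarrow> 'g free_alg \<Rightarrow> 'g free_alg set" where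
  "cls rels x = genideal free_ring rels +>\<^bsub>free_ring\<^esub> x"

text \<open>The locale \<^locale>\<open>algebra\<close> is for commutative algebras only; of \<^theory>\<open>HOL-Algebra.Module\<close>
  only the record type is used, to carry the scalar multiplication.\<close>

definition presented_alg :: "'g free_alg set \<Rightarrow> (scalar, 'g free_alg set) module" where
  "presented_alg rels =
     (let Q = free_ring Quot genideal free_ring rels
      in ring.extend Q (module.fields (\<lambda>r x. cls rels (scal r) \<otimes>\<^bsub>Q\<^esub> x)))"

definition alg_hom :: "('k, 'a) module \<Rightarrow> ('k, 'b) module \<Rightarrow> ('a \<Rightarrow> 'b) set" where
  "alg_hom R S =
     {h \<in> ring_hom R S. \<forall>r. \<forall>x \<in> carrier R. h (r \<odot>\<^bsub>R\<^esub> x) = r \<odot>\<^bsub>S\<^esub> h x}"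

definition alg_iso :: "('k, 'a) module \<Rightarrow> ('k, 'b) module \<Rightarrow> ('a \<Rightarrow> 'b) set" where
  "alg_iso R S = {h \<in> alg_hom R S. bij_betw h (carrier R) (carrier S)}"


section \<open>The localized quantum oscillator algebra\<close>

text \<open>\<open>Gkh\<close> and \<open>Gkhi\<close> stand for the square roots of \<open>Gk\<close> and its inverse \<open>Gki\<close>;
  \<open>GCi\<close> stands for the inverse of the Casimir element.\<close>

datatype osc_gen = Ge | Gf | Gk | Gki | Gkh | Gkhi | GCi

definition osc_rels :: "osc_gen free_alg set" where
  "osc_rels =
    {gen Gk * gen Gki - 1,
     gen Gki * gen Gk - 1,
     gen Gk * gen Ge - scal (tt ^ 2) * (gen Ge * gen Gk),
     gen Gk * gen Gf - scal (inverse tt ^ 2) * (gen Gf * gen Gk),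
     gen Ge * gen Gf - gen Gf * gen Ge - scal (1 / (tt - inverse tt)) * gen Gk}"

definition casimir :: "osc_gen free_alg" where
  "casimir = gen Ge * gen Gf + scal (inverse tt / (tt - inverse tt) ^ 2) * gen Gk"

definition osc_localization_rels :: "osc_gen free_alg set" where
  "osc_localization_rels = {casimir * gen GCi - 1, gen GCi * casimir - 1}"

definition osc_sqrt_rels :: "osc_gen free_alg set" where
  "osc_sqrt_rels =
    {gen Gkh * gen Gkh - gen Gk,
     gen Gkhi * gen Gkhi - gen Gki,
     gen Gkh * gen Gkhi - 1,
     gen Gkhi * gen Gkh - 1,
     gen Gkh * gen Ge - scal tt * (gen Ge * gen Gkh),
     gen Gkh * gen Gf - scal (inverse tt) * (gen Gf * gen Gkh)}"

definition U_rels :: "osc_gen free_alg set" where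
  "U_rels = osc_rels \<union> osc_localization_rels \<union> osc_sqrt_rels"

definition U_loc :: "(scalar, osc_gen free_alg set) module" where
  "U_loc = presented_alg U_rels"


section \<open>The quantum cluster algebra, by generators and relations\<close>

text \<open>\<open>Gas\<close> stands for the mutated cluster variable; \<open>Gbi\<close> and \<open>Gci\<close> for the inverses of the
  frozen variables.\<close>

datatype clu_gen = Ga | Gas | Gb | Gbi | Gc | Gci

definition A_rels :: "clu_gen free_alg set" where
  "A_rels =
    {gen Gb * gen Gbi - 1, gen Gbi * gen Gb - 1,
     gen Gc * gen Gci - 1, gen Gci * gen Gc - 1,
     gen Gb * gen Ga - scal tt * (gen Ga * gen Gb),
     gen Gc * gen Ga - scal tt * (gen Ga * gen Gc),
     gen Gb * gen Gc - gen Gc * gen Gb,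
     gen Ga * gen Gas - (1 + scal (inverse tt) * (gen Gb * gen Gc)),
     gen Gas * gen Ga - (1 + scal tt * (gen Gb * gen Gc)),
     gen Gb * gen Gas - scal (inverse tt) * (gen Gas * gen Gb),
     gen Gc * gen Gas - scal (inverse tt) * (gen Gas * gen Gc)}"

definition A_t :: "(scalar, clu_gen free_alg set) module" where
  "A_t = presented_alg A_rels"

definition zz :: "clu_gen free_alg set" where
  "zz = cls A_rels (gen Gb) \<otimes>\<^bsub>A_t\<^esub> inv\<^bsub>A_t\<^esub> cls A_rels (gen Gc)"


section \<open>The quantum cluster algebra, from its initial quantum seed\<close>

datatype cvar = Va | Vb | Vc

fun Lambda :: "cvar \<Rightarrow> cvar \<Rightarrow> int" where
  "Lambda Va Va = 0"  | "Lambda Va Vb = -1" | "Lambda Va Vc = -1"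
| "Lambda Vb Va = 1"  | "Lambda Vb Vb = 0"  | "Lambda Vb Vc = 0"
| "Lambda Vc Va = 1"  | "Lambda Vc Vb = 0"  | "Lambda Vc Vc = 0"

text \<open>The exchange matrix has one column, as only \<open>Va\<close> is mutable.\<close>

fun Btilde :: "cvar \<Rightarrow> int" where
  "Btilde Va = 0" | "Btilde Vb = 1" | "Btilde Vc = 1"

datatype tor_gen = X cvar | Xi cvar

definition torus_rels :: "tor_gen free_alg set" where
  "torus_rels =
    (\<Union>v. {gen (X v) * gen (Xi v) - 1, gen (Xi v) * gen (X v) - 1}) \<union>
    (\<Union>v w. {gen (X v) * gen (X w) - scal (tt powi Lambda v w) * (gen (X w) * gen (X v))})"

definition torus :: "(scalar, tor_gen free_alg set) module" where
  "torus = presented_alg torus_rels"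

definition xpow :: "cvar \<Rightarrow> int \<Rightarrow> tor_gen free_alg" where
  "xpow v n = (if n \<ge> 0 then gen (X v) ^ nat n else gen (Xi v) ^ nat (- n))"

text \<open>The toric frame of Berenstein and Zelevinsky,
  \<open>M(u) = tt^((1/2) \<Sum>\<^bsub>l<k\<^esub> u\<^sub>k u\<^sub>l \<Lambda>\<^sub>k\<^sub>l) x\<^sub>1^u\<^sub>1 \<cdots> x\<^sub>m^u\<^sub>m\<close>, with respect to the order \<open>Va, Vb, Vc\<close>.
  In general it needs a square root of \<open>tt\<close>. It is only used below at two exponent vectors for
  which the sum is even, so that the division is exact.\<close>

definition toric_frame :: "(cvar \<Rightarrow> int) \<Rightarrow> tor_gen free_alg" where
  "toric_frame u =
     scal (tt powi ((u Vb * u Va * Lambda Vb Va + u Vc * u Va * Lambda Vc Va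
                    + u Vc * u Vb * Lambda Vc Vb) div 2))
     * (xpow Va (u Va) * xpow Vb (u Vb) * xpow Vc (u Vc))"

text \<open>The quantum exchange relation in direction \<open>Va\<close>:
  \<open>x\<^sub>a' = M(-e\<^sub>a + \<Sum>[b\<^sub>i]\<^sub>+ e\<^sub>i) + M(-e\<^sub>a + \<Sum>[-b\<^sub>i]\<^sub>+ e\<^sub>i)\<close>.\<close>

definition a_star :: "tor_gen free_alg" where
  "a_star =
     toric_frame (\<lambda>v. (if v = Va then -1 else 0) + max 0 (Btilde v))
     + toric_frame (\<lambda>v. (if v = Va then -1 else 0) + max 0 (- Btilde v))"

text \<open>The only mutation direction is \<open>Va\<close> and mutating twice gives back the initial seed, so
  that there are two seeds, whose mutable variables are \<open>x\<^sub>a\<close> and \<open>x\<^sub>a'\<close>. Both lie in the initial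
  quantum torus, hence there is no need to pass to its skew field of fractions.\<close>

definition cluster_subalgebra :: "tor_gen free_alg set set" where
  "cluster_subalgebra =
     generate_ring torus
       (range (\<lambda>r. r \<odot>\<^bsub>torus\<^esub> \<one>\<^bsub>torus\<^esub>)
        \<union> cls torus_rels `
            {gen (X Va), a_star, gen (X Vb), gen (Xi Vb), gen (X Vc), gen (Xi Vc)})"

definition quantum_cluster_algebra :: "(scalar, tor_gen free_alg set) module" where
  "quantum_cluster_algebra = torus\<lparr>carrier := cluster_subalgebra\<rparr>"


section \<open>The values of the map on generators\<close>

definition phi_spec :: "(osc_gen free_alg set \<Rightarrow> clu_gen free_alg set) \<Rightarrow> bool" where
  "phi_spec \<phi> \<longleftrightarrow>
     (let a = cls A_rels (gen Ga); as = cls A_rels (gen Gas); b = cls A_rels (gen Gb);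
          k_img = (- ((tt - inverse tt) ^ 2)) \<odot>\<^bsub>A_t\<^esub> (b [^]\<^bsub>A_t\<^esub> (2 :: nat))
      in \<phi> (cls U_rels (gen Ge)) = zz \<otimes>\<^bsub>A_t\<^esub> a
       \<and> \<phi> (cls U_rels (gen Gf)) = as
       \<and> \<phi> (cls U_rels (gen Gk)) = k_img
       \<and> \<phi> (cls U_rels (gen Gki)) = inv\<^bsub>A_t\<^esub> k_img
       \<and> \<phi> (cls U_rels casimir) = zz
       \<and> \<phi> (cls U_rels (gen GCi)) = inv\<^bsub>A_t\<^esub> zz
       \<and> \<phi> (cls U_rels (gen Gkh)) = (- imag * (tt - inverse tt)) \<odot>\<^bsub>A_t\<^esub> b)"

definition presentation_spec :: "(clu_gen free_alg set \<Rightarrow> tor_gen free_alg set) \<Rightarrow> bool" where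
  "presentation_spec \<iota> \<longleftrightarrow>
     \<iota> (cls A_rels (gen Ga)) = cls torus_rels (gen (X Va))
   \<and> \<iota> (cls A_rels (gen Gas)) = cls torus_rels a_star
   \<and> \<iota> (cls A_rels (gen Gb)) = cls torus_rels (gen (X Vb))
   \<and> \<iota> (cls A_rels (gen Gbi)) = cls torus_rels (gen (Xi Vb))
   \<and> \<iota> (cls A_rels (gen Gc)) = cls torus_rels (gen (X Vc))
   \<and> \<iota> (cls A_rels (gen Gci)) = cls torus_rels (gen (Xi Vc))"

end

theory Submission
  imports Defs "HOL-Library.Function_Algebras"
begin

text \<open>Write \<open>t\<close> for \<^const>\<open>tt\<close>, \<open>d = t - 1/t\<close> and \<open>z = b c\<^sup>-\<^sup>1\<close>.

  The variables \<open>b\<close> and \<open>c\<close> pick up the same power of \<open>t\<close> when they move past \<open>a\<close> or past \<open>a*\<close>, so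
  that \<open>z\<close> commutes with every generator. Under the map \<open>\<phi>\<close> the element \<open>k\<close> becomes \<open>-d\<^sup>2 b\<^sup>2\<close> and the
  Casimir element becomes
  \<open>z a a* - t\<^sup>-\<^sup>1 b\<^sup>2 = z (1 + t\<^sup>-\<^sup>1 b c) - t\<^sup>-\<^sup>1 b\<^sup>2 = z\<close>, because \<open>z b c = b\<^sup>2\<close>. Both exchange
  relations of the cluster algebra are therefore the two expressions for the Casimir element, divided
  by it; this is why the Casimir element has to be inverted. Conversely \<open>b\<close> is a multiple of the square
  root of \<open>k\<close>, and then \<open>c = z\<^sup>-\<^sup>1 b\<close> and \<open>a = z\<^sup>-\<^sup>1 e\<close> are forced. Thus \<open>\<phi>\<close> and its inverse are given on
  generators, it is enough to check that each of them respects the relations of its source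
  (\<open>osc_image_relations\<close>, \<open>clu_image_relations\<close>), and the composites are the identity because they are
  so on generators (\<open>osc_clu_iso\<close>). Uniqueness of \<open>\<phi>\<close> holds because its prescribed values determine
  those on all generators: the inverse of the square root of \<open>k\<close>, whose value is not prescribed, must
  go to the inverse of the image of the square root.

  That the presentation describes the subalgebra of the quantum torus generated by the cluster
  variables is a statement of another kind: besides checking relations (\<open>tor_image_relations\<close>) one has
  to see that no further relation holds in the torus. The relations of the presentation suffice to
  reduce every element to a linear combination of the monomials \<open>a\<^sup>n b\<^sup>i c\<^sup>j\<close> and \<open>(a*)\<^sup>n b\<^sup>i c\<^sup>j\<close>, with
  \<open>n\<close> a natural number and \<open>i\<close>, \<open>j\<close> integers (\<open>clu_monomials_span\<close>). In the torus,
  \<open>a* = a\<^sup>-\<^sup>1 (1 + t\<^sup>-\<^sup>1 b c)\<close>, so that \<open>(a*)\<^sup>n b\<^sup>i c\<^sup>j\<close> is \<open>a\<^sup>-\<^sup>n b\<^sup>i c\<^sup>j\<close> plus terms with the same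
  power of \<open>a\<close> and a higher power of \<open>b\<close>. In a vanishing combination, the coefficient of a monomial with the least
  power of \<open>b\<close> must then be zero (\<open>inj_torus_embedding\<close>). To read off coefficients, the torus is made
  to act on functions on the lattice of exponents (\<open>exists_leading_action\<close>).

  The computations need equations in noncommutative rings. They are carried out in a type of the class
  \<^class>\<open>ring\<close>, and transferred to the record of cosets at the end.\<close>

section \<open>Presented algebras as types\<close>

lemma ring_free_ring: "ring (free_ring :: 'g free_alg ring)"
proof (rule ringI)
  show "abelian_group (free_ring :: 'g free_alg ring)"
    by (rule abelian_groupI)
      (auto simp: free_ring_def algebra_simps intro: exI[of _ "- _"])
  show "monoid (free_ring :: 'g free_alg ring)"
    by (rule monoidI) (auto simp: free_ring_def algebra_simps)
qed (auto simp: free_ring_def algebra_simps)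

interpretation free: ring "free_ring :: 'g free_alg ring"
  by (rule ring_free_ring)

lemma free_ring_simps [simp]:
  "carrier free_ring = UNIV" "x \<otimes>\<^bsub>free_ring\<^esub> y = x * y" "\<one>\<^bsub>free_ring\<^esub> = 1"
  "\<zero>\<^bsub>free_ring\<^esub> = 0" "x \<oplus>\<^bsub>free_ring\<^esub> y = x + y"
  by (simp_all add: free_ring_def)

lemma free_ring_uminus [simp]: "\<ominus>\<^bsub>free_ring\<^esub> x = - (x :: 'g free_alg)"
  by (rule free.minus_equality) simp_all

lemma free_ring_minus [simp]: "x \<ominus>\<^bsub>free_ring\<^esub> y = x - (y :: 'g free_alg)"
  by (simp add: free.minus_eq)

lemma ideal_genideal: "ideal (genideal free_ring S) (free_ring :: 'g free_alg ring)"
  by (rule free.genideal_ideal) simp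

lemma genideal_closed:
  fixes S :: "'g free_alg set"
  defines "I \<equiv> genideal free_ring S"
  shows "0 \<in> I" "x \<in> I \<Longrightarrow> y \<in> I \<Longrightarrow> x + y \<in> I" "x \<in> I \<Longrightarrow> - x \<in> I"
    "x \<in> I \<Longrightarrow> y * x \<in> I" "x \<in> I \<Longrightarrow> x * y \<in> I"
proof -
  interpret ideal I free_ring
    unfolding I_def by (rule ideal_genideal)
  show "0 \<in> I" "x \<in> I \<Longrightarrow> y \<in> I \<Longrightarrow> x + y \<in> I" "x \<in> I \<Longrightarrow> - x \<in> I"
    "x \<in> I \<Longrightarrow> y * x \<in> I" "x \<in> I \<Longrightarrow> x * y \<in> I"
    using zero_closed a_closed[of x y] a_inv_closed[of x] I_l_closed[of x y] I_r_closed[of x y]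
    by auto
qed

lemma cls_eq_iff: "cls S x = cls S y \<longleftrightarrow> x - y \<in> genideal free_ring S"
  using free.quotient_eq_iff_same_a_r_cos[OF ideal_genideal, of x y S] by (auto simp: cls_def)

lemma presented_alg_simps:
  "carrier (presented_alg S) = range (cls S)"
  "cls S x \<otimes>\<^bsub>presented_alg S\<^esub> cls S y = cls S (x * y)"
  "cls S x \<oplus>\<^bsub>presented_alg S\<^esub> cls S y = cls S (x + y)"
  "\<one>\<^bsub>presented_alg S\<^esub> = cls S 1"
  "\<zero>\<^bsub>presented_alg S\<^esub> = cls S 0"
  "r \<odot>\<^bsub>presented_alg S\<^esub> cls S y = cls S (scal r * y)"
proof -
  interpret ideal "genideal free_ring S" free_ring
    by (rule ideal_genideal)
  note defs = presented_alg_def Let_def ring.extend_def module.fields_def FactRing_def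
  show "carrier (presented_alg S) = range (cls S)"
    by (auto simp: defs cls_def A_RCOSETS_def' image_def)
  show "cls S x \<otimes>\<^bsub>presented_alg S\<^esub> cls S y = cls S (x * y)"
    "r \<odot>\<^bsub>presented_alg S\<^esub> cls S y = cls S (scal r * y)"
    using rcoset_mult_add by (auto simp: defs cls_def)
  show "cls S x \<oplus>\<^bsub>presented_alg S\<^esub> cls S y = cls S (x + y)"
    using a_rcos_sum[of x y] by (auto simp: defs cls_def)
  show "\<one>\<^bsub>presented_alg S\<^esub> = cls S 1"
    by (auto simp: defs cls_def)
  show "\<zero>\<^bsub>presented_alg S\<^esub> = cls S 0"
    using free.a_rcos_zero[OF ideal_genideal, of 0 S] genideal_closed(1)[of S]
    by (auto simp: defs cls_def)
qed

text \<open>Here the type of generators determines the relations, through a class parameter. This makes the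
  presented algebra a type, on which the simplifier can compute with equality in place of congruence
  modulo an ideal.\<close>

class presented =
  fixes relations :: "'a free_alg set"

quotient_type (overloaded) 'g palg = "'g::presented free_alg" /
  "\<lambda>x y. x - y \<in> genideal free_ring relations"
  morphisms rep_palg of_free
proof (rule equivpI)
  let ?I = "genideal free_ring (relations :: 'g free_alg set)"
  show "reflp (\<lambda>x y. x - y \<in> ?I)"
    by (rule reflpI) (simp add: genideal_closed(1))
  show "symp (\<lambda>x y. x - y \<in> ?I)"
    by (rule sympI) (use genideal_closed(3) in fastforce)
  show "transp (\<lambda>x y. x - y \<in> ?I)"
    by (rule transpI) (use genideal_closed(2) in fastforce)
qed

lemma of_free_rep [simp]: "of_free (rep_palg x) = x"
  by (rule Quotient_abs_rep[OF Quotient_palg])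

lemma scal_1 [simp]: "scal 1 = 1"
  by (simp add: scal_def)

lemma scal_add: "scal (r + s) = scal r + scal s"
  by (simp add: scal_def single_add)

lemma scal_mult: "scal (r * s) = scal r * scal s"
  by (simp add: scal_def mult_single)

text \<open>The sort is not \<open>ring_1\<close>, which includes \<open>1 \<noteq> 0\<close>: the relations may well collapse the algebra.\<close>

instantiation palg :: (presented) "{ring, monoid_mult}"
begin

lift_definition zero_palg :: "'a palg" is 0 .
lift_definition one_palg :: "'a palg" is 1 .

lift_definition plus_palg :: "'a palg \<Rightarrow> 'a palg \<Rightarrow> 'a palg" is "(+)"
  using genideal_closed(2) by (fastforce simp: add_diff_add)

lift_definition uminus_palg :: "'a palg \<Rightarrow> 'a palg" is uminus
  using genideal_closed(3) by fastforce

lift_definition minus_palg :: "'a palg \<Rightarrow> 'a palg \<Rightarrow> 'a palg" is "(-)"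
proof -
  fix x x' y y' :: "'a free_alg"
  assume *: "x - x' \<in> genideal free_ring relations" "y - y' \<in> genideal free_ring relations"
  have "x - y - (x' - y') = (x - x') + - (y - y')"
    by simp
  then show "x - y - (x' - y') \<in> genideal free_ring relations"
    using * genideal_closed(2,3) by metis
qed

lift_definition times_palg :: "'a palg \<Rightarrow> 'a palg \<Rightarrow> 'a palg" is "(*)"
proof -
  fix x x' y y' :: "'a free_alg"
  assume *: "x - x' \<in> genideal free_ring relations" "y - y' \<in> genideal free_ring relations"
  have "x * y - x' * y' = (x - x') * y + x' * (y - y')"
    by (simp add: algebra_simps)
  then show "x * y - x' * y' \<in> genideal free_ring relations"
    using * genideal_closed(2,4,5) by metis
qed

instance
  by standard (transfer; simp add: algebra_simps genideal_closed(1))+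

end

lift_definition scale_palg :: "scalar \<Rightarrow> 'g::presented palg \<Rightarrow> 'g palg" (infixr "\<cdot>" 75)
  is "\<lambda>r x. scal r * x"
proof -
  fix r and x y :: "'g free_alg"
  assume "x - y \<in> genideal free_ring relations"
  moreover have "scal r * x - scal r * y = scal r * (x - y)"
    by (simp add: algebra_simps)
  ultimately show "scal r * x - scal r * y \<in> genideal free_ring relations"
    using genideal_closed(4) by metis
qed

lift_definition pgen :: "'g \<Rightarrow> 'g::presented palg" is gen .

text \<open>The link with the records: an element of the type, as an element of the carrier of the corresponding
  \<^const>\<open>presented_alg\<close>.\<close>

lift_definition coset :: "'g::presented palg \<Rightarrow> 'g free_alg set" is "cls relations"
  by (simp add: cls_eq_iff)

lemma coset_simps:
  fixes x y :: "'g::presented palg"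
  defines "P \<equiv> presented_alg (relations :: 'g free_alg set)"
  shows "coset x \<otimes>\<^bsub>P\<^esub> coset y = coset (x * y)"
    "coset x \<oplus>\<^bsub>P\<^esub> coset y = coset (x + y)"
    "\<one>\<^bsub>P\<^esub> = coset (1 :: 'g palg)"
    "r \<odot>\<^bsub>P\<^esub> coset y = coset (r \<cdot> y)"
  unfolding P_def by (transfer; simp add: presented_alg_simps)+

lemma coset_eq_iff [simp]: "coset x = coset y \<longleftrightarrow> x = y"
  by transfer (simp add: cls_eq_iff)

lemma inj_coset: "inj coset"
  by (simp add: inj_on_def)

lemma coset_of_free: "coset (of_free x) = cls relations x"
  by (simp add: coset.abs_eq)

lemma carrier_presented_alg:
  "carrier (presented_alg relations) = range (coset :: 'g::presented palg \<Rightarrow> _)"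
proof -
  have "range (coset :: 'g palg \<Rightarrow> _) = coset ` range of_free"
    by (simp add: surjI[of of_free rep_palg])
  then show ?thesis
    by (simp add: presented_alg_simps image_image coset_of_free)
qed

lemma of_free_simps [simp]:
  "of_free (x + y) = of_free x + of_free y" "of_free (x * y) = of_free x * of_free y"
  "of_free (x - y) = of_free x - of_free y" "of_free 1 = 1" "of_free (gen g) = pgen g"
  by (simp_all add: plus_palg.abs_eq times_palg.abs_eq minus_palg.abs_eq one_palg.abs_eq
      pgen.abs_eq)

lemma of_free_scal [simp]: "of_free (scal r) = r \<cdot> 1"
  by transfer (simp add: genideal_closed(1))

lemma of_free_scal_mult [simp]: "of_free (scal r * x) = r \<cdot> of_free x"
  by (simp only: scale_palg.abs_eq)

lemma of_free_eq_0_iff: "of_free x = 0 \<longleftrightarrow> x \<in> genideal free_ring relations"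
  by transfer simp

lemma of_free_relation: "x \<in> relations \<Longrightarrow> of_free x = 0"
  unfolding of_free_eq_0_iff by (rule free.genideal_self[THEN subsetD]) auto

lemma free_alg_sum_monomials:
  "(x :: 'g free_alg) = (\<Sum>w\<in>Poly_Mapping.keys x. Poly_Mapping.single w (Poly_Mapping.lookup x w))"
  by (rule poly_mapping_eqI) (simp add: lookup_sum lookup_single when_def in_keys_iff)

lemma free_alg_induct [case_names monomial add]:
  assumes monomial: "\<And>w r. P (Poly_Mapping.single w r)"
    and add: "\<And>x y. P x \<Longrightarrow> P y \<Longrightarrow> P (x + y)"
  shows "P (x :: 'g free_alg)"
proof -
  have "P (\<Sum>w\<in>A. Poly_Mapping.single w (Poly_Mapping.lookup x w))" if "finite A" for A
    using that
  proof induction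
    case empty
    show ?case
      using monomial[of 0 0] by simp
  qed (auto intro: add monomial)
  then show ?thesis
    by (subst free_alg_sum_monomials) simp
qed

lemma scal_central: "scal r * x = x * scal r"
  by (induction x rule: free_alg_induct)
    (simp_all add: scal_def mult_single mult.commute algebra_simps)

lemma monomial_eq:
  "Poly_Mapping.single (Word w) r = scal r * prod_list (map gen w)"
proof (induction w)
  case Nil
  show ?case
    by (simp add: scal_def flip: zero_word_def)
next
  case (Cons g w)
  have "Poly_Mapping.single (Word (g # w)) r = gen g * Poly_Mapping.single (Word w) r"
    by (simp add: gen_def mult_single plus_word_def)
  also have "\<dots> = gen g * scal r * prod_list (map gen w)"
    by (simp add: Cons mult.assoc)
  also have "\<dots> = scal r * prod_list (map gen (g # w))"
    by (simp add: mult.assoc scal_central[symmetric])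
  finally show ?case .
qed

lemma scale_palg_simps:
  fixes x y :: "'g::presented palg"
  shows "r \<cdot> (x + y) = r \<cdot> x + r \<cdot> y" "(r + s) \<cdot> x = r \<cdot> x + s \<cdot> x"
    "r \<cdot> s \<cdot> x = (r * s) \<cdot> x" "1 \<cdot> x = x"
    "(r \<cdot> x) * y = r \<cdot> (x * y)" "x * (r \<cdot> y) = r \<cdot> (x * y)"
proof -
  show "r \<cdot> (x + y) = r \<cdot> x + r \<cdot> y" "(r + s) \<cdot> x = r \<cdot> x + s \<cdot> x"
    "r \<cdot> s \<cdot> x = (r * s) \<cdot> x" "1 \<cdot> x = x" "(r \<cdot> x) * y = r \<cdot> (x * y)"
    by (transfer; simp add: algebra_simps scal_add scal_mult genideal_closed(1))+
  have "x * (r \<cdot> y) = of_free (rep_palg x) * (r \<cdot> of_free (rep_palg y))"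
    by simp
  also have "\<dots> = of_free (rep_palg x * (scal r * rep_palg y))"
    by (simp only: scale_palg.abs_eq times_palg.abs_eq)
  also have "\<dots> = of_free (scal r * (rep_palg x * rep_palg y))"
    by (simp only: mult.assoc[symmetric] scal_central[of r "rep_palg x"])
  also have "\<dots> = r \<cdot> (of_free (rep_palg x) * of_free (rep_palg y))"
    by (simp only: scale_palg.abs_eq times_palg.abs_eq)
  finally show "x * (r \<cdot> y) = r \<cdot> (x * y)"
    by simp
qed

interpretation palg: vector_space "(\<cdot>) :: scalar \<Rightarrow> 'g::presented palg \<Rightarrow> 'g palg"
  by standard (simp_all add: scale_palg_simps)

declare scale_palg_simps(5,6) [simp]

lemma palg_induct [case_names one gen add mult scale]:
  fixes x :: "'g::presented palg"
  assumes one: "P 1"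
    and gen: "\<And>g. P (pgen g)"
    and add: "\<And>x y. P x \<Longrightarrow> P y \<Longrightarrow> P (x + y)"
    and mult: "\<And>x y. P x \<Longrightarrow> P y \<Longrightarrow> P (x * y)"
    and scale: "\<And>r x. P x \<Longrightarrow> P (r \<cdot> x)"
  shows "P x"
proof -
  have word: "P (of_free (prod_list (map gen w)))" for w
    by (induction w) (simp_all add: one gen mult)
  have "P (of_free y)" for y
  proof (induction y rule: free_alg_induct)
    case (monomial w r)
    show ?case
      using scale[OF word, of r]
      by (cases w) (simp add: monomial_eq scale_palg_simps)
  qed (simp add: add)
  from this[of "rep_palg x"] show ?thesis
    by simp
qed

section \<open>The universal property\<close>

text \<open>Both maps into another presented algebra and representations on a vector space arise from letting
  generators act by linear operators; a map of algebras is the case of left multiplications. For this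
  reason the universal property is stated for actions first.\<close>

definition word_action :: "(scalar \<Rightarrow> 'v \<Rightarrow> 'v::ab_group_add) \<Rightarrow> ('g \<Rightarrow> 'v \<Rightarrow> 'v) \<Rightarrow>
    'g free_alg \<Rightarrow> 'v \<Rightarrow> 'v" where
  "word_action scale T x v =
    (\<Sum>w\<in>Poly_Mapping.keys x. scale (Poly_Mapping.lookup x w) (foldr T (letters w) v))"

locale generator_action = vector_space scale
  for scale :: "scalar \<Rightarrow> 'v::ab_group_add \<Rightarrow> 'v" +
  fixes T :: "'g \<Rightarrow> 'v \<Rightarrow> 'v"
  assumes T_add: "T g (u + v) = T g u + T g v"
    and T_scale: "T g (scale r v) = scale r (T g v)"
begin

abbreviation act :: "'g free_alg \<Rightarrow> 'v \<Rightarrow> 'v" where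
  "act \<equiv> word_action scale T"

lemma foldr_add: "foldr T w (u + v) = foldr T w u + foldr T w v"
  by (induction w) (simp_all add: T_add)

lemma foldr_scale: "foldr T w (scale r v) = scale r (foldr T w v)"
  by (induction w) (simp_all add: T_scale)

lemma act_single: "act (Poly_Mapping.single w r) v = scale r (foldr T (letters w) v)"
  by (simp add: word_action_def)

lemma act_add: "act (x + y) v = act x v + act y v"
  unfolding word_action_def
  by (rule setsum_keys_plus_distrib) (simp_all add: scale_left_distrib)

lemma act_zero: "act 0 v = 0"
  by (simp add: word_action_def)

lemma act_uminus: "act (- x) v = - act x v"
  using act_add[of x "- x" v] by (simp add: act_zero eq_neg_iff_add_eq_0 add.commute)

lemma act_diff: "act (x - y) v = act x v - act y v"
  using act_add[of x "- y" v] by (simp add: act_uminus)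

lemma act_vec_add: "act x (u + v) = act x u + act x v"
  by (simp add: word_action_def foldr_add scale_right_distrib sum.distrib)

lemma act_vec_scale: "act x (scale r v) = scale r (act x v)"
  by (simp add: word_action_def foldr_scale scale_sum_right mult.commute)

lemma act_mult: "act (x * y) v = act x (act y v)"
proof (induction x rule: free_alg_induct)
  case (monomial w r)
  show ?case
  proof (induction y rule: free_alg_induct)
    case (monomial w' r')
    show ?case
      by (simp add: mult_single act_single foldr_scale plus_word_def)
  qed (simp add: act_add act_vec_add distrib_left)
qed (simp add: act_add distrib_right)

lemma act_one: "act 1 v = v"
  using act_single[of 0 1 v] by (simp only: single_one) (simp add: zero_word_def)

lemma act_scal: "act (scal r) v = scale r v"
  by (simp add: scal_def act_single zero_word_def)

lemma act_gen: "act (gen g) v = T g v"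
  by (simp add: gen_def act_single)

lemmas act_simps = act_zero act_one act_scal act_gen act_mult act_add act_diff act_uminus

text \<open>The elements that act by zero form a two-sided ideal.\<close>

lemma act_genideal:
  assumes "\<And>r v. r \<in> S \<Longrightarrow> act r v = 0" and "x \<in> genideal free_ring S"
  shows "act x v = 0"
proof -
  let ?K = "{x. \<forall>v. act x v = 0}"
  have [simp]: "act x 0 = 0" for x
    using act_vec_scale[of x 0 0] by simp
  have "ideal ?K free_ring"
  proof (rule idealI)
    show "subgroup ?K (add_monoid free_ring)"
      by (rule free.add.subgroupI)
        (auto simp: act_simps a_inv_def[symmetric] intro: exI[of _ 0])
  qed (auto simp: act_simps ring_free_ring)
  then have "genideal free_ring S \<subseteq> ?K"
    by (rule free.genideal_minimal) (use assms(1) in auto)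
  with assms(2) show ?thesis
    by auto
qed

end

theorem exists_action:
  fixes T :: "'g::presented \<Rightarrow> 'v::ab_group_add \<Rightarrow> 'v"
  assumes "generator_action scale T"
    and relation: "\<And>r v. r \<in> relations \<Longrightarrow> word_action scale T r v = 0"
  obtains \<rho> :: "'g palg \<Rightarrow> 'v \<Rightarrow> 'v" where
    "\<And>x y v. \<rho> (x + y) v = \<rho> x v + \<rho> y v"
    "\<And>x y v. \<rho> (x * y) v = \<rho> x (\<rho> y v)"
    "\<And>v. \<rho> 1 v = v"
    "\<And>r x v. \<rho> (r \<cdot> x) v = scale r (\<rho> x v)"
    "\<And>g v. \<rho> (pgen g) v = T g v"
proof -
  interpret generator_action scale T by fact
  define \<rho> where "\<rho> x = act (rep_palg x)" for x :: "'g palg"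
  have \<rho>: "\<rho> (of_free x) v = act x v" for x v
  proof -
    have "of_free (rep_palg (of_free x) - x) = 0"
      by simp
    then have "act (rep_palg (of_free x) - x) v = 0"
      by (intro act_genideal[OF relation]) (simp_all only: of_free_eq_0_iff)
    then show ?thesis
      by (simp add: \<rho>_def act_diff)
  qed
  show ?thesis
  proof
    fix x y :: "'g palg" and v
    obtain x' y' where x: "x = of_free x'" and y: "y = of_free y'"
      using of_free_rep[of x, symmetric] of_free_rep[of y, symmetric] by blast
    show "\<rho> (x + y) v = \<rho> x v + \<rho> y v"
      by (simp only: x y \<rho> act_simps flip: of_free_simps)
    show "\<rho> (x * y) v = \<rho> x (\<rho> y v)"
      by (simp only: x y \<rho> act_simps flip: of_free_simps)
    show "\<rho> 1 v = v"
      by (simp only: \<rho> act_simps flip: of_free_simps)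
    show "\<rho> (pgen g) v = T g v" for g
      by (simp only: \<rho> act_simps flip: of_free_simps)
    show "\<rho> (r \<cdot> x) v = scale r (\<rho> x v)" for r
      by (simp only: x scale_palg.abs_eq \<rho> act_simps)
  qed
qed

definition alg_map :: "('g::presented palg \<Rightarrow> 'h::presented palg) \<Rightarrow> bool" where
  "alg_map h \<longleftrightarrow> h 1 = 1 \<and> (\<forall>x y. h (x + y) = h x + h y) \<and> (\<forall>x y. h (x * y) = h x * h y)
    \<and> (\<forall>r x. h (r \<cdot> x) = r \<cdot> h x)"

lemma alg_mapD:
  assumes "alg_map h"
  shows "h 1 = 1" "h (x + y) = h x + h y" "h (x * y) = h x * h y" "h (r \<cdot> x) = r \<cdot> h x"
    "h 0 = 0" "h (- x) = - h x" "h (x - y) = h x - h y"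
proof -
  show *: "h 1 = 1" "h (x + y) = h x + h y" "h (x * y) = h x * h y" "h (r \<cdot> x) = r \<cdot> h x"
    for x y r
    using assms by (simp_all add: alg_map_def)
  show "h 0 = 0"
    using *(4)[of 0 0] by simp
  show m: "h (- x) = - h x" for x
    using *(4)[of "-1" x] by simp
  show "h (x - y) = h x - h y"
    using *(2)[of x "- y"] m by simp
qed

lemma alg_map_eqI:
  assumes h: "alg_map h" and h': "alg_map h'" and gen: "\<And>g. h (pgen g) = h' (pgen g)"
  shows "h = h'"
proof
  show "h x = h' x" for x
    by (induction x rule: palg_induct) (simp_all add: gen alg_mapD[OF h] alg_mapD[OF h'])
qed

lemma alg_map_comp: "alg_map h \<Longrightarrow> alg_map h' \<Longrightarrow> alg_map (h \<circ> h')"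
  by (simp add: alg_map_def)

lemma alg_map_id: "alg_map id"
  by (simp add: alg_map_def)

definition eval_gens :: "('g \<Rightarrow> 'h::presented palg) \<Rightarrow> 'g free_alg \<Rightarrow> 'h palg" where
  "eval_gens f x = word_action (\<cdot>) (\<lambda>g y. f g * y) x 1"

lemma generator_action_left_mult: "generator_action (\<cdot>) (\<lambda>g y. f g * (y :: 'h::presented palg))"
  by standard (simp_all add: scale_palg_simps algebra_simps)

lemma word_action_left_mult:
  fixes f :: "'g \<Rightarrow> 'h::presented palg"
  shows "word_action (\<cdot>) (\<lambda>g y. f g * (y :: 'h::presented palg)) x v = eval_gens f x * v"
proof -
  interpret generator_action "(\<cdot>)" "\<lambda>g y. f g * (y :: 'h::presented palg)"
    by (rule generator_action_left_mult)
  have "foldr (\<lambda>g y. f g * y) w v = foldr (\<lambda>g y. f g * y) w 1 * v" for w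
    by (induction w) (simp_all add: mult.assoc)
  then show ?thesis
    by (induction x rule: free_alg_induct)
      (simp_all add: eval_gens_def act_single act_add scale_palg_simps distrib_right)
qed

lemma eval_gens_simps [simp]:
  fixes f :: "'g \<Rightarrow> 'h::presented palg"
  shows "eval_gens f 1 = 1" "eval_gens f (scal r) = r \<cdot> 1" "eval_gens f (gen g) = f g"
  "eval_gens f (x + y) = eval_gens f x + eval_gens f y"
  "eval_gens f (x - y) = eval_gens f x - eval_gens f y"
  "eval_gens f (x * y) = eval_gens f x * eval_gens f y"
proof -
  interpret generator_action "(\<cdot>)" "\<lambda>g y. f g * (y :: 'h::presented palg)"
    by (rule generator_action_left_mult)
  show "eval_gens f (x * y) = eval_gens f x * eval_gens f y"
    by (simp only: eval_gens_def[of f "x * y"] act_mult) (simp only: word_action_left_mult mult_1_right)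
qed (simp_all add: eval_gens_def generator_action.act_simps[OF generator_action_left_mult])

text \<open>An algebra that acts on another one by operators which, on generators, are left multiplications acts
  by left multiplications throughout, so that sending \<open>x\<close> to its value at \<open>1\<close> is multiplicative.\<close>

theorem exists_alg_map:
  fixes f :: "'g::presented \<Rightarrow> 'h::presented palg"
  assumes "\<And>r. r \<in> relations \<Longrightarrow> eval_gens f r = 0"
  obtains h where "alg_map h" "\<And>g. h (pgen g) = f g"
proof -
  have "word_action (\<cdot>) (\<lambda>g y. f g * y) r v = 0" if "r \<in> relations" for r v
    using that by (simp add: word_action_left_mult assms)
  then obtain \<rho> :: "'g palg \<Rightarrow> 'h palg \<Rightarrow> 'h palg" where
    \<rho>: "\<And>x y v. \<rho> (x + y) v = \<rho> x v + \<rho> y v"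
      "\<And>x y v. \<rho> (x * y) v = \<rho> x (\<rho> y v)"
      "\<And>v. \<rho> 1 v = v"
      "\<And>r x v. \<rho> (r \<cdot> x) v = r \<cdot> \<rho> x v"
      "\<And>g v. \<rho> (pgen g) v = f g * v"
    using exists_action[OF generator_action_left_mult[of f]] by blast
  have left: "\<rho> x v = \<rho> x 1 * v" for x v
  proof (induction x arbitrary: v rule: palg_induct)
    case (mult x y)
    have "\<rho> x (\<rho> y v) = \<rho> x 1 * (\<rho> y 1 * v)"
      using mult.IH(1)[of "\<rho> y v"] mult.IH(2)[of v] by simp
    also have "\<dots> = \<rho> x (\<rho> y 1) * v"
      using mult.IH(1)[of "\<rho> y 1"] by (simp add: mult.assoc)
    finally show ?case
      by (simp add: \<rho>)
  next
    case (add x y)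
    show ?case
      by (simp add: \<rho> distrib_right add.IH(1)[of v] add.IH(2)[of v])
  next
    case (scale r x)
    show ?case
      using scale.IH[of v] by (simp add: \<rho> scale_palg_simps)
  qed (simp_all add: \<rho>)
  have "\<rho> (x * y) 1 = \<rho> x 1 * \<rho> y 1" for x y
    by (simp only: \<rho> left[of x "\<rho> y 1"])
  then have "alg_map (\<lambda>x. \<rho> x 1)"
    by (simp add: alg_map_def \<rho>)
  then show ?thesis
    by (rule that) (simp add: \<rho>)
qed

section \<open>From types to records of cosets\<close>

lemma ring_presented_alg: "ring (presented_alg (relations :: 'g::presented free_alg set))"
proof (rule ringI)
  let ?P = "presented_alg (relations :: 'g free_alg set)"
  have zero: "\<zero>\<^bsub>?P\<^esub> = coset (0 :: 'g palg)"
    by transfer (simp add: presented_alg_simps)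
  show "abelian_group ?P"
  proof (rule abelian_groupI)
    fix x assume "x \<in> carrier ?P"
    then obtain x' where "x = coset (x' :: 'g palg)"
      by (auto simp: carrier_presented_alg)
    then show "\<exists>y\<in>carrier ?P. y \<oplus>\<^bsub>?P\<^esub> x = \<zero>\<^bsub>?P\<^esub>"
      by (auto simp: carrier_presented_alg coset_simps zero intro: exI[of _ "- x'"])
  qed (auto simp: carrier_presented_alg coset_simps zero algebra_simps)
  show "monoid ?P"
    by (rule monoidI) (auto simp: carrier_presented_alg coset_simps algebra_simps)
qed (auto simp: carrier_presented_alg coset_simps algebra_simps)

lemma coset_uminus_power_inv:
  fixes x :: "'g::presented palg"
  defines "P \<equiv> presented_alg (relations :: 'g free_alg set)"
  shows "\<ominus>\<^bsub>P\<^esub> coset x = coset (- x)"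
    "coset x [^]\<^bsub>P\<^esub> (n :: nat) = coset (x ^ n)"
    "x * y = 1 \<Longrightarrow> y * x = 1 \<Longrightarrow> inv\<^bsub>P\<^esub> coset x = coset y"
proof -
  interpret P: ring P
    unfolding P_def by (rule ring_presented_alg)
  have zero: "\<zero>\<^bsub>P\<^esub> = coset (0 :: 'g palg)"
    unfolding P_def by transfer (simp add: presented_alg_simps)
  note simps = coset_simps[where 'g = 'g, folded P_def] carrier_presented_alg[where 'g = 'g, folded P_def]
  show "\<ominus>\<^bsub>P\<^esub> coset x = coset (- x)"
    by (rule P.minus_equality) (auto simp: simps zero)
  show "coset x [^]\<^bsub>P\<^esub> n = coset (x ^ n)"
    by (induction n) (simp_all add: simps power_Suc2 del: power_Suc)
  show "inv\<^bsub>P\<^esub> coset x = coset y" if "x * y = 1" "y * x = 1"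
    by (rule P.inv_char) (auto simp: simps that)
qed

definition transport :: "('g::presented palg \<Rightarrow> 'h::presented palg) \<Rightarrow>
    'g free_alg set \<Rightarrow> 'h free_alg set" where
  "transport h S = coset (h (inv_into UNIV coset S))"

lemma transport_coset [simp]: "transport h (coset x) = coset (h x)"
  by (simp add: transport_def inv_f_f[OF inj_coset])

text \<open>The target has its carrier cut down to the image, to cover embeddings as well as isomorphisms.\<close>

lemma transport_alg_iso_range:
  fixes h :: "'g::presented palg \<Rightarrow> 'h::presented palg"
  assumes h: "alg_map h" and "inj h"
  shows "transport h \<in> alg_iso (presented_alg relations)
           ((presented_alg relations)\<lparr>carrier := range (\<lambda>x. coset (h x))\<rparr>)"
proof -
  have "bij_betw (transport h) (range coset) (range (\<lambda>x. coset (h x)))"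
    using \<open>inj h\<close> by (simp add: bij_betw_def inj_on_def image_image)
  then show ?thesis
    by (auto simp: alg_iso_def alg_hom_def ring_hom_def carrier_presented_alg coset_simps
        alg_mapD[OF h])
qed

lemma transport_alg_iso:
  fixes h :: "'g::presented palg \<Rightarrow> 'h::presented palg"
  assumes h: "alg_map h" and "bij h"
  shows "transport h \<in> alg_iso (presented_alg relations) (presented_alg relations)"
proof -
  let ?P = "presented_alg (relations :: 'h free_alg set)"
  have "range (\<lambda>x. coset (h x)) = coset ` range h"
    by auto
  also have "\<dots> = carrier ?P"
    using \<open>bij h\<close> by (simp add: carrier_presented_alg bij_def)
  finally have "?P\<lparr>carrier := range (\<lambda>x. coset (h x))\<rparr> = ?P"
    by simp
  then show ?thesis
    using transport_alg_iso_range[OF h] \<open>bij h\<close> by (simp add: bij_def)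
qed

lemma alg_homE:
  fixes \<psi> :: "'g::presented free_alg set \<Rightarrow> 'h::presented free_alg set"
  assumes \<psi>: "\<psi> \<in> alg_hom (presented_alg relations) (presented_alg relations)"
  obtains h :: "'g palg \<Rightarrow> 'h palg" where "alg_map h" "\<And>x. \<psi> (coset x) = coset (h x)"
proof -
  have "\<psi> (coset x) \<in> range (coset :: 'h palg \<Rightarrow> _)" for x :: "'g palg"
    using \<psi> by (auto simp: alg_hom_def ring_hom_def carrier_presented_alg Pi_def)
  then have "\<exists>y :: 'h palg. \<psi> (coset x) = coset y" for x :: "'g palg"
    by (auto simp: image_iff)
  then obtain h :: "'g palg \<Rightarrow> 'h palg" where h: "\<And>x. \<psi> (coset x) = coset (h x)"
    by metis
  have "\<psi> (coset x \<otimes>\<^bsub>presented_alg relations\<^esub> coset y) =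
        \<psi> (coset x) \<otimes>\<^bsub>presented_alg relations\<^esub> \<psi> (coset y)"
    "\<psi> (coset x \<oplus>\<^bsub>presented_alg relations\<^esub> coset y) =
        \<psi> (coset x) \<oplus>\<^bsub>presented_alg relations\<^esub> \<psi> (coset y)"
    "\<psi> \<one>\<^bsub>presented_alg relations\<^esub> = \<one>\<^bsub>presented_alg relations\<^esub>"
    "\<psi> (r \<odot>\<^bsub>presented_alg relations\<^esub> coset x) =
        r \<odot>\<^bsub>presented_alg relations\<^esub> \<psi> (coset x)"
    for x y :: "'g palg" and r
    using \<psi> by (simp_all add: alg_hom_def ring_hom_def carrier_presented_alg)
  then have "alg_map h"
    by (simp add: alg_map_def coset_simps h)
  then show ?thesis
    using h by (rule that)
qed

section \<open>Scalars\<close>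

lemma tt_nonzero [simp]: "tt \<noteq> 0"
  by (simp add: tt_def Zero_fract_def eq_fract)

lemma imag_square [simp]: "imag * imag = -1" "imag * (x * (imag * y)) = - (x * y)"
proof -
  show "imag * imag = -1"
    by (simp add: imag_def One_fract_def eq_fract) (simp add: one_pCons)
  moreover have "imag * (x * (imag * y)) = imag * imag * (x * y)"
    by (simp only: ac_simps)
  ultimately show "imag * (x * (imag * y)) = - (x * y)"
    by simp
qed

lemma tt_neq_inverse [simp]: "tt \<noteq> inverse tt"
proof
  assume "tt = inverse tt"
  then have "tt * tt = 1"
    by (metis right_inverse tt_nonzero)
  then show False
    by (simp add: tt_def One_fract_def eq_fract one_pCons)
qed

text \<open>The square root of \<open>k\<close> and \<open>b\<close> correspond up to the factors \<open>\<gamma>\<close> and \<open>\<beta> = 1/\<gamma>\<close>. Writing all scalars of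
  the oscillator relations through them leaves cancellation of \<open>\<beta>\<close> against \<open>\<gamma>\<close> as the only arithmetic
  with denominators.\<close>

definition \<beta> :: scalar where
  "\<beta> = imag / (tt - inverse tt)"

definition \<gamma> :: scalar where
  "\<gamma> = - imag * (tt - inverse tt)"

lemma \<beta>_\<gamma> [simp]:
  "\<beta> * \<gamma> = 1" "\<beta> * (\<gamma> * s) = s" "\<beta> * (r * \<gamma>) = r" "\<beta> * (r * (\<gamma> * s)) = r * s"
  "\<gamma> * \<beta> = 1" "\<gamma> * (\<beta> * s) = s" "\<gamma> * (r * \<beta>) = r" "\<gamma> * (r * (\<beta> * s)) = r * s"
proof -
  show *: "\<beta> * \<gamma> = 1" "\<gamma> * \<beta> = 1"
    by (simp_all add: \<beta>_def \<gamma>_def)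
  have "\<beta> * (\<gamma> * s) = \<beta> * \<gamma> * s" "\<beta> * (r * \<gamma>) = \<beta> * \<gamma> * r"
    "\<beta> * (r * (\<gamma> * s)) = \<beta> * \<gamma> * (r * s)" "\<gamma> * (\<beta> * s) = \<beta> * \<gamma> * s"
    "\<gamma> * (r * \<beta>) = \<beta> * \<gamma> * r" "\<gamma> * (r * (\<beta> * s)) = \<beta> * \<gamma> * (r * s)"
    by (simp_all only: ac_simps)
  then show "\<beta> * (\<gamma> * s) = s" "\<beta> * (r * \<gamma>) = r" "\<beta> * (r * (\<gamma> * s)) = r * s"
    "\<gamma> * (\<beta> * s) = s" "\<gamma> * (r * \<beta>) = r" "\<gamma> * (r * (\<beta> * s)) = r * s"
    by (simp_all add: *)
qed

lemma scalars_via_\<beta>: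
  "inverse tt / (tt - inverse tt)\<^sup>2 = - (inverse tt * (\<beta> * \<beta>))"
  "1 / (tt - inverse tt) = inverse tt * (\<beta> * \<beta>) - tt * (\<beta> * \<beta>)"
proof -
  define d where "d = tt - inverse tt"
  have "d \<noteq> 0" and \<beta>: "\<beta> * \<beta> = - (1 / (d * d))"
    by (simp_all add: \<beta>_def d_def)
  then have "1 / d = - d * (\<beta> * \<beta>)"
    by simp
  also have "\<dots> = inverse tt * (\<beta> * \<beta>) - tt * (\<beta> * \<beta>)"
    by (simp add: d_def left_diff_distrib)
  finally show "1 / (tt - inverse tt) = inverse tt * (\<beta> * \<beta>) - tt * (\<beta> * \<beta>)"
    by (simp add: d_def)
  show "inverse tt / (tt - inverse tt)\<^sup>2 = - (inverse tt * (\<beta> * \<beta>))"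
    by (simp add: \<beta> power2_eq_square flip: d_def)
qed

instantiation osc_gen :: presented
begin
definition relations_osc_gen :: "osc_gen free_alg set" where "relations = U_rels"
instance ..
end

instantiation clu_gen :: presented
begin
definition relations_clu_gen :: "clu_gen free_alg set" where "relations = A_rels"
instance ..
end

instantiation tor_gen :: presented
begin
definition relations_tor_gen :: "tor_gen free_alg set" where "relations = torus_rels"
instance ..
end


section \<open>Commutation up to a scalar\<close>

lemma q_commute_inverse:
  fixes x xi y :: "'g::presented palg"
  assumes "xi * x = 1" "x * xi = 1" "x * y = r \<cdot> (y * x)" "r \<noteq> 0"
  shows "xi * y = inverse r \<cdot> (y * xi)"
proof -
  have "y * xi = xi * (x * y) * xi"
    by (simp add: assms(1) flip: mult.assoc)
  also have "\<dots> = r \<cdot> (xi * y * (x * xi))"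
    by (simp add: assms(3) scale_palg_simps mult.assoc)
  also have "\<dots> = r \<cdot> (xi * y)"
    by (simp add: assms(2))
  finally show ?thesis
    using \<open>r \<noteq> 0\<close> by simp
qed

lemma commute_inverse:
  fixes x xi y :: "'g::presented palg"
  assumes "xi * x = 1" "x * xi = 1" "x * y = y * x"
  shows "xi * y = y * xi"
  using q_commute_inverse[of xi x y 1] assms by simp

text \<open>An equation between products of two generators rewrites inside a longer product, bracketed to
  the right, only together with this form of it.\<close>

lemma mult_rules_assoc:
  fixes x y w :: "'g::presented palg"
  shows "x * y = u \<Longrightarrow> x * (y * w) = u * w"
  by (simp flip: mult.assoc)

section \<open>Relations in the quantum cluster algebra\<close>

text \<open>The relations are oriented so that rewriting moves \<open>a\<close> and \<open>a*\<close> to the left, \<open>c\<close> to the right and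
  \<open>b\<close> in between, which brings products into a normal form.\<close>

lemma A_relations:
  "pgen Gb * pgen Gbi = 1" "pgen Gbi * pgen Gb = 1"
  "pgen Gc * pgen Gci = 1" "pgen Gci * pgen Gc = 1"
  "pgen Gb * pgen Ga = tt \<cdot> (pgen Ga * pgen Gb)"
  "pgen Gc * pgen Ga = tt \<cdot> (pgen Ga * pgen Gc)"
  "pgen Gc * pgen Gb = pgen Gb * pgen Gc"
  "pgen Ga * pgen Gas = 1 + inverse tt \<cdot> (pgen Gb * pgen Gc)"
  "pgen Gas * pgen Ga = 1 + tt \<cdot> (pgen Gb * pgen Gc)"
  "pgen Gb * pgen Gas = inverse tt \<cdot> (pgen Gas * pgen Gb)"
  "pgen Gc * pgen Gas = inverse tt \<cdot> (pgen Gas * pgen Gc)"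
proof -
  have "\<forall>x\<in>A_rels. of_free x = 0"
    by (metis of_free_relation relations_clu_gen_def)
  then show
    "pgen Gb * pgen Gbi = 1" "pgen Gbi * pgen Gb = 1"
    "pgen Gc * pgen Gci = 1" "pgen Gci * pgen Gc = 1"
    "pgen Gb * pgen Ga = tt \<cdot> (pgen Ga * pgen Gb)"
    "pgen Gc * pgen Ga = tt \<cdot> (pgen Ga * pgen Gc)"
    "pgen Gc * pgen Gb = pgen Gb * pgen Gc"
    "pgen Ga * pgen Gas = 1 + inverse tt \<cdot> (pgen Gb * pgen Gc)"
    "pgen Gas * pgen Ga = 1 + tt \<cdot> (pgen Gb * pgen Gc)"
    "pgen Gb * pgen Gas = inverse tt \<cdot> (pgen Gas * pgen Gb)"
    "pgen Gc * pgen Gas = inverse tt \<cdot> (pgen Gas * pgen Gc)"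
    by (simp_all add: A_rels_def)
qed

lemma A_inverse_relations:
  "pgen Gbi * pgen Ga = inverse tt \<cdot> (pgen Ga * pgen Gbi)"
  "pgen Gci * pgen Ga = inverse tt \<cdot> (pgen Ga * pgen Gci)"
  "pgen Gbi * pgen Gas = tt \<cdot> (pgen Gas * pgen Gbi)"
  "pgen Gci * pgen Gas = tt \<cdot> (pgen Gas * pgen Gci)"
  "pgen Gc * pgen Gbi = pgen Gbi * pgen Gc"
  "pgen Gci * pgen Gb = pgen Gb * pgen Gci"
  "pgen Gci * pgen Gbi = pgen Gbi * pgen Gci"
proof -
  note inv = A_relations(1-4)
  show "pgen Gbi * pgen Ga = inverse tt \<cdot> (pgen Ga * pgen Gbi)"
    by (rule q_commute_inverse[OF inv(2,1) A_relations(5)]) simp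
  show "pgen Gci * pgen Ga = inverse tt \<cdot> (pgen Ga * pgen Gci)"
    by (rule q_commute_inverse[OF inv(4,3) A_relations(6)]) simp
  show "pgen Gbi * pgen Gas = tt \<cdot> (pgen Gas * pgen Gbi)"
    using q_commute_inverse[OF inv(2,1) A_relations(10)] by simp
  show "pgen Gci * pgen Gas = tt \<cdot> (pgen Gas * pgen Gci)"
    using q_commute_inverse[OF inv(4,3) A_relations(11)] by simp
  show bi: "pgen Gc * pgen Gbi = pgen Gbi * pgen Gc"
    by (rule commute_inverse[OF inv(2,1) A_relations(7)[symmetric], symmetric])
  show "pgen Gci * pgen Gb = pgen Gb * pgen Gci"
    by (rule commute_inverse[OF inv(4,3) A_relations(7)])
  show "pgen Gci * pgen Gbi = pgen Gbi * pgen Gci"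
    by (rule commute_inverse[OF inv(4,3) bi])
qed

lemmas A_rewrite =
  A_relations A_relations[THEN mult_rules_assoc]
  A_inverse_relations A_inverse_relations[THEN mult_rules_assoc]
  scale_palg_simps distrib_left distrib_right left_diff_distrib right_diff_distrib mult.assoc

definition z_A :: "clu_gen palg" where
  "z_A = pgen Gb * pgen Gci"

lemma z_A_central: "z_A * x = x * z_A"
proof (induction x rule: palg_induct)
  case (gen g)
  show ?case
    by (cases g) (simp_all add: z_A_def A_rewrite)
next
  case (mult x y)
  then show ?case
    by (metis mult.assoc)
qed (simp_all add: algebra_simps scale_palg_simps)

lemma zz_eq: "zz = coset z_A"
proof -
  have "inv\<^bsub>presented_alg relations\<^esub> coset (pgen Gc :: clu_gen palg) = coset (pgen Gci)"
    by (rule coset_uminus_power_inv(3)) (simp_all add: A_relations)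
  then show ?thesis
    unfolding zz_def A_t_def z_A_def
    by (simp add: coset_simps flip: relations_clu_gen_def coset_of_free)
qed

definition osc_image :: "osc_gen \<Rightarrow> clu_gen palg" where
  "osc_image g = (case g of
      Ge \<Rightarrow> z_A * pgen Ga
    | Gf \<Rightarrow> pgen Gas
    | Gk \<Rightarrow> (\<gamma> * \<gamma>) \<cdot> (pgen Gb * pgen Gb)
    | Gki \<Rightarrow> (\<beta> * \<beta>) \<cdot> (pgen Gbi * pgen Gbi)
    | Gkh \<Rightarrow> \<gamma> \<cdot> pgen Gb
    | Gkhi \<Rightarrow> \<beta> \<cdot> pgen Gbi
    | GCi \<Rightarrow> pgen Gc * pgen Gbi)"

lemma osc_image_relations:
  assumes "r \<in> U_rels"
  shows "eval_gens osc_image r = 0"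
proof -
  have "z_A * pgen Ga = pgen Ga * (pgen Gb * pgen Gci)"
    by (simp add: z_A_def A_rewrite)
  then show ?thesis
    using assms unfolding U_rels_def osc_rels_def osc_localization_rels_def osc_sqrt_rels_def
    by (elim UnE insertE emptyE)
      (simp_all add: casimir_def osc_image_def scalars_via_\<beta> A_rewrite power2_eq_square[of tt]
        power2_eq_square[of "inverse tt"] palg.scale_left_diff_distrib
        palg.scale_right_diff_distrib)
qed

section \<open>Relations in the localized oscillator algebra\<close>

definition cas :: "osc_gen palg" where
  "cas = of_free casimir"

text \<open>The generators \<open>k\<close> and \<open>k\<^sup>-\<^sup>1\<close> are eliminated in favour of the square roots. The products \<open>ef\<close> and
  \<open>fe\<close> are expressed by the Casimir element; these two equations turn into the exchange relations.\<close>

lemma U_relations: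
  "pgen Gk = pgen Gkh * pgen Gkh" "pgen Gki = pgen Gkhi * pgen Gkhi"
  "pgen Gkh * pgen Gkhi = 1" "pgen Gkhi * pgen Gkh = 1"
  "pgen Gkh * pgen Ge = tt \<cdot> (pgen Ge * pgen Gkh)"
  "pgen Gkh * pgen Gf = inverse tt \<cdot> (pgen Gf * pgen Gkh)"
  "pgen Ge * pgen Gf = cas + (inverse tt * (\<beta> * \<beta>)) \<cdot> (pgen Gkh * pgen Gkh)"
  "pgen Gf * pgen Ge = cas + (tt * (\<beta> * \<beta>)) \<cdot> (pgen Gkh * pgen Gkh)"
  "cas * pgen GCi = 1" "pgen GCi * cas = 1"
proof -
  have "\<forall>x\<in>U_rels. of_free x = 0"
    by (metis of_free_relation relations_osc_gen_def)
  then have rel: "pgen Gkh * pgen Gkh = pgen Gk" "pgen Gkhi * pgen Gkhi = pgen Gki"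
    "pgen Gkh * pgen Gkhi = 1" "pgen Gkhi * pgen Gkh = 1"
    "pgen Gkh * pgen Ge = tt \<cdot> (pgen Ge * pgen Gkh)"
    "pgen Gkh * pgen Gf = inverse tt \<cdot> (pgen Gf * pgen Gkh)"
    "cas * pgen GCi = 1" "pgen GCi * cas = 1"
    "pgen Ge * pgen Gf - pgen Gf * pgen Ge = (1 / (tt - inverse tt)) \<cdot> pgen Gk"
    by (simp_all add: U_rels_def osc_rels_def osc_localization_rels_def osc_sqrt_rels_def cas_def)
  then show "pgen Gk = pgen Gkh * pgen Gkh" "pgen Gki = pgen Gkhi * pgen Gkhi"
    "pgen Gkh * pgen Gkhi = 1" "pgen Gkhi * pgen Gkh = 1"
    "pgen Gkh * pgen Ge = tt \<cdot> (pgen Ge * pgen Gkh)"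
    "pgen Gkh * pgen Gf = inverse tt \<cdot> (pgen Gf * pgen Gkh)"
    "cas * pgen GCi = 1" "pgen GCi * cas = 1"
    by simp_all
  show ef: "pgen Ge * pgen Gf = cas + (inverse tt * (\<beta> * \<beta>)) \<cdot> (pgen Gkh * pgen Gkh)"
    by (simp add: cas_def casimir_def scalars_via_\<beta> rel)
  have "pgen Gf * pgen Ge = pgen Ge * pgen Gf - (1 / (tt - inverse tt)) \<cdot> pgen Gk"
    by (simp flip: rel(9))
  then show "pgen Gf * pgen Ge = cas + (tt * (\<beta> * \<beta>)) \<cdot> (pgen Gkh * pgen Gkh)"
    by (simp add: ef scalars_via_\<beta> palg.scale_left_diff_distrib rel(1))
qed

lemma U_inverse_relations:
  "pgen Gkhi * pgen Ge = inverse tt \<cdot> (pgen Ge * pgen Gkhi)"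
  "pgen Gkhi * pgen Gf = tt \<cdot> (pgen Gf * pgen Gkhi)"
proof -
  show "pgen Gkhi * pgen Ge = inverse tt \<cdot> (pgen Ge * pgen Gkhi)"
    by (rule q_commute_inverse[OF U_relations(4,3,5)]) simp
  show "pgen Gkhi * pgen Gf = tt \<cdot> (pgen Gf * pgen Gkhi)"
    using q_commute_inverse[OF U_relations(4,3,6)] by simp
qed

text \<open>Here the two expressions for the Casimir element are played against each other: the product with \<open>e\<close>
  on the left is computed by the one containing \<open>fe\<close>, the product on the right by the one containing
  \<open>ef\<close>, and both give \<open>efe\<close> minus the same multiple of \<open>ek\<close>.\<close>

lemma cas_commute_gens:
  "pgen Ge * cas = cas * pgen Ge" "pgen Gf * cas = cas * pgen Gf"
  "pgen Gkh * cas = cas * pgen Gkh"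
proof -
  have ef: "cas = pgen Ge * pgen Gf - (inverse tt * (\<beta> * \<beta>)) \<cdot> (pgen Gkh * pgen Gkh)"
    by (simp add: U_relations)
  have fe: "cas = pgen Gf * pgen Ge - (tt * (\<beta> * \<beta>)) \<cdot> (pgen Gkh * pgen Gkh)"
    by (simp add: U_relations)
  note rewrite = U_relations(5,6) U_relations(5,6)[THEN mult_rules_assoc]
    left_diff_distrib right_diff_distrib mult.assoc
  have "pgen Ge * cas = pgen Ge * (pgen Gf * pgen Ge)
      - (tt * (\<beta> * \<beta>)) \<cdot> (pgen Ge * (pgen Gkh * pgen Gkh))"
    by (subst fe) (simp add: rewrite)
  also have "\<dots> = cas * pgen Ge"
    by (subst ef) (simp add: rewrite)
  finally show "pgen Ge * cas = cas * pgen Ge" .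
  have "pgen Gf * cas = pgen Gf * (pgen Ge * pgen Gf)
      - (inverse tt * (\<beta> * \<beta>)) \<cdot> (pgen Gf * (pgen Gkh * pgen Gkh))"
    by (subst ef) (simp add: rewrite)
  also have "\<dots> = cas * pgen Gf"
    by (subst fe) (simp add: rewrite)
  finally show "pgen Gf * cas = cas * pgen Gf" .
  show "pgen Gkh * cas = cas * pgen Gkh"
    by (subst (1 2) ef) (simp add: rewrite)
qed

lemma cas_central: "x * cas = cas * x"
proof (induction x rule: palg_induct)
  case (gen g)
  note e = cas_commute_gens
  have khi: "pgen Gkhi * cas = cas * pgen Gkhi"
    by (rule commute_inverse[OF U_relations(4,3) e(3)])
  have "cas * (pgen Gkh * pgen Gkh) = pgen Gkh * pgen Gkh * cas"
    "cas * (pgen Gkhi * pgen Gkhi) = pgen Gkhi * pgen Gkhi * cas"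
    by (metis e(3) mult.assoc, metis khi mult.assoc)
  then show ?case
    by (cases g) (simp_all add: e khi U_relations)
next
  case (mult x y)
  then show ?case
    by (metis mult.assoc)
qed (simp_all add: algebra_simps scale_palg_simps)

lemma inverse_cas_central: "x * pgen GCi = pgen GCi * x"
  by (rule commute_inverse[OF U_relations(10,9) cas_central[symmetric], symmetric])

text \<open>As rewrite rules: the Casimir element and its inverse move to the far left. The side conditions keep
  the rules from exchanging these two forever.\<close>

lemma inverse_cas_rewrite:
  assumes "NO_MATCH (pgen GCi) x" "NO_MATCH cas x"
  shows "x * pgen GCi = pgen GCi * x" "x * (pgen GCi * y) = pgen GCi * (x * y)"
    "x * cas = cas * x" "x * (cas * y) = cas * (x * y)"
  by (metis cas_central inverse_cas_central mult.assoc)+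

lemmas U_rewrite =
  U_relations U_relations(3-10)[THEN mult_rules_assoc]
  U_inverse_relations U_inverse_relations[THEN mult_rules_assoc] inverse_cas_rewrite
  scale_palg_simps distrib_left distrib_right left_diff_distrib right_diff_distrib mult.assoc

text \<open>The inverse of the map on generators: \<open>a = z\<^sup>-\<^sup>1 e\<close> and \<open>c = z\<^sup>-\<^sup>1 b\<close>, where \<open>z\<close> is the image of the Casimir
  element.\<close>

definition clu_image :: "clu_gen \<Rightarrow> osc_gen palg" where
  "clu_image g = (case g of
      Ga \<Rightarrow> pgen GCi * pgen Ge
    | Gas \<Rightarrow> pgen Gf
    | Gb \<Rightarrow> \<beta> \<cdot> pgen Gkh
    | Gbi \<Rightarrow> \<gamma> \<cdot> pgen Gkhi
    | Gc \<Rightarrow> \<beta> \<cdot> (pgen GCi * pgen Gkh)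
    | Gci \<Rightarrow> \<gamma> \<cdot> (cas * pgen Gkhi))"

lemma clu_image_relations:
  assumes "r \<in> A_rels"
  shows "eval_gens clu_image r = 0"
  using assms unfolding A_rels_def
  by (elim UnE insertE emptyE)
    (simp_all add: clu_image_def U_rewrite mult.commute[of _ tt] mult.commute[of _ "inverse tt"])

section \<open>The isomorphism with the oscillator algebra\<close>

lemma coset_gen:
  "cls U_rels (gen g) = coset (pgen g)" "cls U_rels casimir = coset cas"
  "cls A_rels (gen g') = coset (pgen g')" "cls torus_rels (gen g'') = coset (pgen g'')"
  "cls torus_rels x = coset (of_free x)"
  by (simp_all add: cas_def coset_of_free relations_osc_gen_def relations_clu_gen_def
      relations_tor_gen_def flip: of_free_simps(5))

lemma U_loc_eq: "U_loc = presented_alg relations"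
  by (simp add: U_loc_def relations_osc_gen_def)

lemma A_t_eq: "A_t = presented_alg relations"
  by (simp add: A_t_def relations_clu_gen_def)

lemma torus_eq: "torus = presented_alg relations"
  by (simp add: torus_def relations_tor_gen_def)

lemma osc_image_inverses:
  "osc_image Gk * osc_image Gki = 1" "osc_image Gki * osc_image Gk = 1"
  "osc_image Gkh * osc_image Gkhi = 1"
  "z_A * osc_image GCi = 1" "osc_image GCi * z_A = 1"
  by (simp_all add: osc_image_def z_A_def A_rewrite mult.assoc)

text \<open>The generator \<^const>\<open>Gkhi\<close> is the one whose value is not prescribed.\<close>

lemma phi_spec_iff:
  assumes "\<And>x. \<psi> (coset x) = coset (h x)"
  shows "phi_spec \<psi> \<longleftrightarrow> (\<forall>g. g \<noteq> Gkhi \<longrightarrow> h (pgen g) = osc_image g) \<and> h cas = z_A"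
proof -
  have inv: "inv\<^bsub>presented_alg relations\<^esub> coset (osc_image Gk) = coset (osc_image Gki)"
    "inv\<^bsub>presented_alg relations\<^esub> coset z_A = coset (osc_image GCi)"
    by (intro coset_uminus_power_inv(3) osc_image_inverses)+
  have k: "(- ((tt - inverse tt) ^ 2)) \<cdot> (pgen Gb ^ 2) = osc_image Gk"
    by (simp add: osc_image_def \<gamma>_def power2_eq_square mult.assoc)
  have h: "(- imag * (tt - inverse tt)) \<cdot> pgen Gb = osc_image Gkh"
    by (simp add: osc_image_def \<gamma>_def)
  have e: "z_A * pgen Ga = osc_image Ge" and f: "pgen Gas = osc_image Gf"
    by (simp_all add: osc_image_def)
  have all: "(\<forall>g. g \<noteq> Gkhi \<longrightarrow> P g) \<longleftrightarrow> P Ge \<and> P Gf \<and> P Gk \<and> P Gki \<and> P GCi \<and> P Gkh" for P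
    by (metis osc_gen.distinct osc_gen.exhaust)
  show ?thesis
    unfolding phi_spec_def Let_def A_t_eq coset_gen zz_eq coset_simps coset_uminus_power_inv(2) k h inv e
      assms coset_eq_iff f all
    by blast
qed

theorem osc_clu_iso:
  obtains \<phi> where "alg_map \<phi>" "bij \<phi>" "\<And>g. \<phi> (pgen g) = osc_image g" "\<phi> cas = z_A"
proof -
  obtain \<phi> where \<phi>: "alg_map \<phi>" "\<And>g. \<phi> (pgen g) = osc_image g"
    by (rule exists_alg_map[of osc_image])
      (auto simp: relations_osc_gen_def intro: osc_image_relations)
  obtain \<eta> where \<eta>: "alg_map \<eta>" "\<And>g. \<eta> (pgen g) = clu_image g"
    by (rule exists_alg_map[of clu_image])
      (auto simp: relations_clu_gen_def intro: clu_image_relations)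
  note maps = alg_mapD[OF \<phi>(1)] alg_mapD[OF \<eta>(1)] \<phi>(2) \<eta>(2)
  have cas: "\<phi> cas = z_A"
  proof -
    have "\<phi> cas = \<phi> (pgen Ge * pgen Gf - (inverse tt * (\<beta> * \<beta>)) \<cdot> pgen Gk)"
      by (simp add: U_relations)
    also have "\<dots> = z_A * pgen Ga * pgen Gas - inverse tt \<cdot> (pgen Gb * pgen Gb)"
      by (simp add: maps osc_image_def mult.assoc)
    also have "\<dots> = z_A"
      by (simp add: z_A_def A_rewrite)
    finally show ?thesis .
  qed
  have "\<phi> \<circ> \<eta> = id"
  proof (rule alg_map_eqI[OF alg_map_comp[OF \<phi>(1) \<eta>(1)] alg_map_id])
    show "(\<phi> \<circ> \<eta>) (pgen g) = id (pgen g)" for g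
      by (cases g) (simp_all add: maps clu_image_def osc_image_def cas z_A_def A_rewrite)
  qed
  moreover have "\<eta> \<circ> \<phi> = id"
  proof (rule alg_map_eqI[OF alg_map_comp[OF \<eta>(1) \<phi>(1)] alg_map_id])
    show "(\<eta> \<circ> \<phi>) (pgen g) = id (pgen g)" for g
      by (cases g) (simp_all add: maps clu_image_def osc_image_def z_A_def U_rewrite)
  qed
  ultimately have "bij \<phi>"
    using o_bij by blast
  then show ?thesis
    using \<phi> cas by (intro that)
qed

theorem exists_unique_phi:
  "\<exists>\<phi> \<in> alg_iso U_loc A_t. phi_spec \<phi>
     \<and> (\<forall>\<psi> \<in> alg_hom U_loc A_t. phi_spec \<psi> \<longrightarrow> (\<forall>x \<in> carrier U_loc. \<psi> x = \<phi> x))"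
proof -
  obtain \<phi> where \<phi>: "alg_map \<phi>" "bij \<phi>" "\<And>g. \<phi> (pgen g) = osc_image g" "\<phi> cas = z_A"
    using osc_clu_iso by blast
  have "\<psi> u = transport \<phi> u"
    if hom: "\<psi> \<in> alg_hom U_loc A_t" and spec: "phi_spec \<psi>" and u: "u \<in> carrier U_loc" for \<psi> u
  proof -
    obtain h where h: "alg_map h" "\<And>x. \<psi> (coset x) = coset (h x)"
      using alg_homE[OF hom[unfolded U_loc_eq A_t_eq]] by blast
    from spec have gens: "h (pgen g) = osc_image g" if "g \<noteq> Gkhi" for g
      using that by (simp add: phi_spec_iff[of \<psi> h, OF h(2)])
    \<comment> \<open>A left inverse and a right inverse of the image of \<^const>\<open>Gkh\<close> coincide.\<close>
    have "h (pgen Gkhi) = h (pgen Gkhi * pgen Gkh) * osc_image Gkhi"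
      by (simp add: alg_mapD[OF h(1)] gens mult.assoc osc_image_inverses)
    also have "\<dots> = osc_image Gkhi"
      by (simp add: U_relations alg_mapD[OF h(1)])
    finally have "h (pgen g) = \<phi> (pgen g)" for g
      using gens[of g] by (cases "g = Gkhi") (simp_all add: \<phi>(3))
    then have "h = \<phi>"
      by (rule alg_map_eqI[OF h(1) \<phi>(1)])
    then show ?thesis
      using u h(2) by (auto simp: U_loc_eq carrier_presented_alg)
  qed
  moreover have "phi_spec (transport \<phi>)"
    using \<phi> by (simp add: phi_spec_iff[of "transport \<phi>" \<phi>])
  moreover have "transport \<phi> \<in> alg_iso U_loc A_t"
    unfolding U_loc_eq A_t_eq by (rule transport_alg_iso[OF \<phi>(1,2)])
  ultimately show ?thesis
    by blast
qed

section \<open>The quantum torus\<close>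

lemma torus_relations:
  "pgen (X v) * pgen (Xi v) = 1" "pgen (Xi v) * pgen (X v) = 1"
  "pgen (X v) * pgen (X w) = (tt powi Lambda v w) \<cdot> (pgen (X w) * pgen (X v))"
proof -
  have rel: "of_free x = 0" if "x \<in> torus_rels" for x :: "tor_gen free_alg"
    using that by (intro of_free_relation) (simp add: relations_tor_gen_def)
  have "gen (X v) * gen (Xi v) - 1 \<in> torus_rels" "gen (Xi v) * gen (X v) - 1 \<in> torus_rels"
    unfolding torus_rels_def by blast+
  from this[THEN rel] show "pgen (X v) * pgen (Xi v) = 1" "pgen (Xi v) * pgen (X v) = 1"
    by simp_all
  have "gen (X v) * gen (X w) - scal (tt powi Lambda v w) * (gen (X w) * gen (X v)) \<in> torus_rels"
    unfolding torus_rels_def by blast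
  from rel[OF this] show
    "pgen (X v) * pgen (X w) = (tt powi Lambda v w) \<cdot> (pgen (X w) * pgen (X v))"
    by simp
qed

lemma torus_inverse_relations:
  "pgen (X v) * pgen (Xi w) = (tt powi - Lambda v w) \<cdot> (pgen (Xi w) * pgen (X v))"
proof -
  have Lambda: "Lambda v w = - Lambda w v"
    by (cases v; cases w) simp_all
  have "pgen (Xi w) * pgen (X v) = (tt powi - Lambda w v) \<cdot> (pgen (X v) * pgen (Xi w))"
    using q_commute_inverse[OF torus_relations(2,1) torus_relations(3)]
    by (simp add: power_int_minus)
  then show ?thesis
    by (simp add: Lambda power_int_minus)
qed

lemmas torus_commutation =
  torus_relations(3)[of Vb Va, simplified] torus_relations(3)[of Vc Va, simplified]
  torus_relations(3)[of Vc Vb, simplified]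
  torus_inverse_relations[of Vb Va, simplified] torus_inverse_relations[of Vc Va, simplified]

lemmas torus_rewrite =
  torus_relations(1,2) torus_relations(1,2)[THEN mult_rules_assoc]
  torus_commutation torus_commutation[THEN mult_rules_assoc]
  scale_palg_simps distrib_left distrib_right left_diff_distrib right_diff_distrib mult.assoc

text \<open>In terms of the initial cluster, \<open>a* = a\<^sup>-\<^sup>1 (1 + t\<^sup>-\<^sup>1 b c)\<close>.\<close>

lemma of_free_a_star:
  "of_free a_star =
    inverse tt \<cdot> (pgen (Xi Va) * (pgen (X Vb) * pgen (X Vc))) + pgen (Xi Va)"
  by (simp add: a_star_def toric_frame_def xpow_def mult.assoc)

definition tor_image :: "clu_gen \<Rightarrow> tor_gen palg" where
  "tor_image g = (case g of
      Ga \<Rightarrow> pgen (X Va)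
    | Gas \<Rightarrow> of_free a_star
    | Gb \<Rightarrow> pgen (X Vb)
    | Gbi \<Rightarrow> pgen (Xi Vb)
    | Gc \<Rightarrow> pgen (X Vc)
    | Gci \<Rightarrow> pgen (Xi Vc))"

lemma tor_image_relations:
  assumes "r \<in> A_rels"
  shows "eval_gens tor_image r = 0"
  using assms unfolding A_rels_def
  by (elim UnE insertE emptyE)
    (simp_all add: tor_image_def of_free_a_star torus_rewrite)

text \<open>The regular representation of the quantum torus, in coordinates: the value at \<open>(n, i, j)\<close> is the
  coefficient of \<open>a\<^sup>n b\<^sup>i c\<^sup>j\<close>. The powers of \<open>t\<close> come from moving \<open>b\<close> or \<open>c\<close> past \<open>a\<^sup>n\<close>. All functions are
  allowed, finitely supported or not.\<close>

type_synonym torus_vec = "int \<Rightarrow> int \<Rightarrow> int \<Rightarrow> scalar"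

fun torus_op :: "tor_gen \<Rightarrow> torus_vec \<Rightarrow> torus_vec" where
  "torus_op (X Va) v = (\<lambda>n i j. v (n - 1) i j)"
| "torus_op (Xi Va) v = (\<lambda>n i j. v (n + 1) i j)"
| "torus_op (X Vb) v = (\<lambda>n i j. tt powi n * v n (i - 1) j)"
| "torus_op (Xi Vb) v = (\<lambda>n i j. tt powi - n * v n (i + 1) j)"
| "torus_op (X Vc) v = (\<lambda>n i j. tt powi n * v n i (j - 1))"
| "torus_op (Xi Vc) v = (\<lambda>n i j. tt powi - n * v n i (j + 1))"

lemma torus_op_action:
  "generator_action (\<lambda>r v n i j. r * v n i j) torus_op"
proof
  fix g r and u v :: torus_vec
  show "torus_op g (u + v) = torus_op g u + torus_op g v"
    by (cases "(g, v)" rule: torus_op.cases) (auto simp: fun_eq_iff algebra_simps)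
  show "torus_op g (\<lambda>n i j. r * v n i j) = (\<lambda>n i j. r * torus_op g v n i j)"
    by (cases "(g, v)" rule: torus_op.cases) (auto simp: fun_eq_iff algebra_simps)
qed (auto simp: fun_eq_iff algebra_simps)

lemma torus_op_relations:
  assumes "r \<in> torus_rels"
  shows "word_action (\<lambda>r v n i j. r * v n i j) torus_op r v = 0"
proof -
  interpret generator_action "\<lambda>r v n i j. r * v n i j" torus_op
    by (rule torus_op_action)
  have inv: "tt powi n * (tt powi - n * x) = x" "tt powi - n * (tt powi n * x) = x" for n x
    by (simp_all add: power_int_minus)
  have comm: "torus_op (X v) (torus_op (X w) u) =
      (\<lambda>n i j. tt powi Lambda v w * torus_op (X w) (torus_op (X v) u) n i j)" for v w u
    by (cases v; cases w)
      (auto simp: fun_eq_iff power_int_diff power_int_add power_int_minus field_simps)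
  have inverse: "torus_op (X v) (torus_op (Xi v) u) = u" "torus_op (Xi v) (torus_op (X v) u) = u"
    for v u
    by (cases v; simp add: inv)+
  from assms consider v where "r = gen (X v) * gen (Xi v) - 1 \<or> r = gen (Xi v) * gen (X v) - 1"
    | v w where "r = gen (X v) * gen (X w) - scal (tt powi Lambda v w) * (gen (X w) * gen (X v))"
    unfolding torus_rels_def by blast
  then show ?thesis
  proof cases
    case 1
    then show ?thesis
      by (auto simp: act_simps inverse)
  next
    case 2
    then show ?thesis
      by (simp add: act_simps comm[of v w])
  qed
qed

section \<open>A spanning set of the cluster algebra\<close>

text \<open>For \<open>y\<close> inverse to \<open>x\<close> these are the integer powers of \<open>x\<close>. The definition also serves for \<open>a\<close> and
  \<open>a*\<close>, which are not inverse to each other; there multiplication by \<open>x\<close> shifts the exponent only when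
  it is not negative.\<close>

definition ipow :: "'r::monoid_mult \<Rightarrow> 'r \<Rightarrow> int \<Rightarrow> 'r" where
  "ipow x y n = (if n \<ge> 0 then x ^ nat n else y ^ nat (- n))"

lemma ipow_0 [simp]: "ipow x y 0 = 1"
  by (simp add: ipow_def)

lemma ipow_step_nonneg: "n \<ge> 0 \<Longrightarrow> x * ipow x y n = ipow x y (n + 1)"
  by (simp add: ipow_def nat_add_distrib)

lemma ipow_step_nonpos:
  assumes "n \<le> 0"
  shows "y * ipow x y n = ipow x y (n - 1)"
proof -
  have neg: "ipow x y (- int k) = y ^ k" for k
    by (cases k) (simp_all add: ipow_def nat_add_distrib)
  obtain k where k: "n = - int k"
    using \<open>n \<le> 0\<close> by (metis nonpos_int_cases)
  then have "n - 1 = - int (Suc k)"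
    by simp
  then show ?thesis
    by (simp only: k neg power_Suc)
qed

lemma ipow_induct [case_names zero up down]:
  assumes "P 0" "\<And>n. n \<ge> 0 \<Longrightarrow> P n \<Longrightarrow> P (n + 1)" "\<And>n. n \<le> 0 \<Longrightarrow> P n \<Longrightarrow> P (n - 1)"
  shows "P (n :: int)"
  using assms by (induction n rule: int_induct[of _ 0]) auto


lemma ipow_step_up: "x * y = 1 \<Longrightarrow> x * ipow x y n = ipow x y (n + 1)"
  using ipow_step_nonneg[of n x y] ipow_step_nonpos[of "n + 1" y x]
  by (cases "n \<ge> 0") (simp_all flip: mult.assoc, metis mult.assoc mult_1_left)

lemma ipow_step_down: "y * x = 1 \<Longrightarrow> y * ipow x y n = ipow x y (n - 1)"
  using ipow_step_nonneg[of "n - 1" x y] ipow_step_nonpos[of n y x]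
  by (cases "n \<le> 0") (simp_all flip: mult.assoc, metis mult.assoc mult_1_left)

lemma q_commute_ipow:
  fixes x y u :: "'g::presented palg"
  assumes x: "u * x = r \<cdot> (x * u)" and y: "u * y = inverse r \<cdot> (y * u)" and r: "r \<noteq> 0"
  shows "u * ipow x y n = (r powi n) \<cdot> (ipow x y n * u)"
proof (induction n rule: ipow_induct)
  case (up n)
  have "u * ipow x y (n + 1) = r \<cdot> (x * (u * ipow x y n))"
    using up(1) by (simp add: x mult.assoc flip: ipow_step_nonneg mult.assoc)
  then show ?case
    using up r by (simp add: power_int_add mult.commute mult.assoc flip: ipow_step_nonneg)
next
  case (down n)
  have "u * ipow x y (n - 1) = inverse r \<cdot> (y * (u * ipow x y n))"
    using down(1) by (simp add: y mult.assoc flip: ipow_step_nonpos mult.assoc)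
  then show ?case
    using down r
    by (simp add: power_int_diff divide_inverse mult.commute mult.assoc flip: ipow_step_nonpos)
qed simp

definition clu_monomial :: "int \<Rightarrow> int \<Rightarrow> int \<Rightarrow> clu_gen palg" where
  "clu_monomial n i j =
    ipow (pgen Ga) (pgen Gas) n * (ipow (pgen Gb) (pgen Gbi) i * ipow (pgen Gc) (pgen Gci) j)"

lemma frozen_mult_clu_monomial:
  "pgen Gb * clu_monomial n i j = (tt powi n) \<cdot> clu_monomial n (i + 1) j"
  "pgen Gbi * clu_monomial n i j = (inverse tt powi n) \<cdot> clu_monomial n (i - 1) j"
  "pgen Gc * clu_monomial n i j = (tt powi n) \<cdot> clu_monomial n i (j + 1)"
  "pgen Gci * clu_monomial n i j = (inverse tt powi n) \<cdot> clu_monomial n i (j - 1)"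
proof -
  have a: "u * (ipow (pgen Ga) (pgen Gas) n * w) =
      (r powi n) \<cdot> (ipow (pgen Ga) (pgen Gas) n * (u * w))"
    if "u * pgen Ga = r \<cdot> (pgen Ga * u)" "u * pgen Gas = inverse r \<cdot> (pgen Gas * u)" "r \<noteq> 0"
    for u w r
    using q_commute_ipow[OF that, of n] by (simp add: mult.assoc flip: mult.assoc[of u])
  have b: "u * (ipow (pgen Gb) (pgen Gbi) i * w) = ipow (pgen Gb) (pgen Gbi) i * (u * w)"
    if "u * pgen Gb = pgen Gb * u" "u * pgen Gbi = pgen Gbi * u" for u w
    using q_commute_ipow[of u "pgen Gb" 1 "pgen Gbi" i] that
    by (simp add: mult.assoc flip: mult.assoc[of u])
  note step = ipow_step_up ipow_step_down
  note rel = A_relations A_inverse_relations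
  show "pgen Gb * clu_monomial n i j = (tt powi n) \<cdot> clu_monomial n (i + 1) j"
    unfolding clu_monomial_def
    by (subst a[where r = tt]) (simp_all add: rel step flip: mult.assoc[of "pgen Gb"])
  show "pgen Gbi * clu_monomial n i j = (inverse tt powi n) \<cdot> clu_monomial n (i - 1) j"
    unfolding clu_monomial_def
    by (subst a[where r = "inverse tt"]) (simp_all add: rel step flip: mult.assoc[of "pgen Gbi"])
  show "pgen Gc * clu_monomial n i j = (tt powi n) \<cdot> clu_monomial n i (j + 1)"
    unfolding clu_monomial_def
    by (subst a[where r = tt]) (simp_all add: rel b step)
  show "pgen Gci * clu_monomial n i j = (inverse tt powi n) \<cdot> clu_monomial n i (j - 1)"
    unfolding clu_monomial_def
    by (subst a[where r = "inverse tt"]) (simp_all add: rel b step)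
qed

text \<open>When \<open>a\<close> meets \<open>a*\<close>, an exchange relation removes both and leaves a polynomial in \<open>b c\<close>, which the
  frozen variables absorb.\<close>

lemma mutable_mult_clu_monomial:
  shows "n \<ge> 0 \<Longrightarrow> pgen Ga * clu_monomial n i j = clu_monomial (n + 1) i j"
    and "n < 0 \<Longrightarrow> pgen Ga * clu_monomial n i j = clu_monomial (n + 1) i j
          + inverse tt \<cdot> (pgen Gb * (pgen Gc * clu_monomial (n + 1) i j))"
    and "n \<le> 0 \<Longrightarrow> pgen Gas * clu_monomial n i j = clu_monomial (n - 1) i j"
    and "n > 0 \<Longrightarrow> pgen Gas * clu_monomial n i j = clu_monomial (n - 1) i j
          + tt \<cdot> (pgen Gb * (pgen Gc * clu_monomial (n - 1) i j))"
proof -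
  have up: "pgen Ga * clu_monomial n i j = clu_monomial (n + 1) i j" if "n \<ge> 0" for n
    using that by (simp add: clu_monomial_def flip: mult.assoc ipow_step_nonneg)
  have down: "pgen Gas * clu_monomial n i j = clu_monomial (n - 1) i j" if "n \<le> 0" for n
    using that by (simp add: clu_monomial_def flip: mult.assoc ipow_step_nonpos)
  show "n \<ge> 0 \<Longrightarrow> pgen Ga * clu_monomial n i j = clu_monomial (n + 1) i j"
    by (rule up)
  show "n \<le> 0 \<Longrightarrow> pgen Gas * clu_monomial n i j = clu_monomial (n - 1) i j"
    by (rule down)
  show "pgen Ga * clu_monomial n i j = clu_monomial (n + 1) i j
      + inverse tt \<cdot> (pgen Gb * (pgen Gc * clu_monomial (n + 1) i j))" if "n < 0"
  proof -
    have "pgen Ga * clu_monomial n i j = pgen Ga * (pgen Gas * clu_monomial (n + 1) i j)"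
      using down[of "n + 1"] that by simp
    then show ?thesis
      by (simp add: A_relations distrib_right flip: mult.assoc)
  qed
  show "pgen Gas * clu_monomial n i j = clu_monomial (n - 1) i j
      + tt \<cdot> (pgen Gb * (pgen Gc * clu_monomial (n - 1) i j))" if "n > 0"
  proof -
    have "pgen Gas * clu_monomial n i j = pgen Gas * (pgen Ga * clu_monomial (n - 1) i j)"
      using up[of "n - 1"] that by simp
    then show ?thesis
      by (simp add: A_relations distrib_right flip: mult.assoc)
  qed
qed

definition clu_monomials :: "clu_gen palg set" where
  "clu_monomials = {clu_monomial n i j | n i j. True}"

text \<open>Every element is a sum of products of generators, and the span of the monomials contains \<open>1\<close> and is
  stable under left multiplication by each generator.\<close>

theorem clu_monomials_span: "x \<in> palg.span clu_monomials"
proof -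
  let ?S = "palg.span clu_monomials"
  have mono: "clu_monomial n i j \<in> ?S" for n i j
    by (rule palg.span_base) (auto simp: clu_monomials_def)
  have gen_mono: "pgen g * clu_monomial n i j \<in> ?S" for g n i j
  proof (cases g)
    case Ga
    show ?thesis
      unfolding Ga by (cases "n \<ge> 0")
        (simp_all add: mutable_mult_clu_monomial frozen_mult_clu_monomial mono
          palg.span_add palg.span_scale del: palg.scale_scale)
  next
    case Gas
    show ?thesis
      unfolding Gas by (cases "n \<le> 0")
        (simp_all add: mutable_mult_clu_monomial frozen_mult_clu_monomial mono
          palg.span_add palg.span_scale)
  qed (simp_all add: frozen_mult_clu_monomial mono palg.span_scale)
  have gen: "pgen g * y \<in> ?S" if "y \<in> ?S" for g y
    using that
  proof (induction rule: palg.span_induct_alt)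
    case (step c w y)
    then have "pgen g * w \<in> ?S"
      using gen_mono by (auto simp: clu_monomials_def)
    with step show ?case
      by (simp add: distrib_left palg.span_add palg.span_scale)
  qed (simp add: palg.span_zero)
  have "x * y \<in> ?S" if "y \<in> ?S" for x y
    using that
  proof (induction x arbitrary: y rule: palg_induct)
    case (mult x1 x2)
    then show ?case
      by (simp add: mult.assoc)
  qed (simp_all add: gen distrib_right palg.span_add palg.span_scale)
  from this[of "clu_monomial 0 0 0" x] mono[of 0 0 0] show ?thesis
    by (simp add: clu_monomial_def)
qed


section \<open>Embedding into the quantum torus\<close>

text \<open>The coefficient at \<open>(n, i, j)\<close> is normalised to \<open>1\<close>, and all other terms have the same power of \<open>a\<close> and a
  strictly higher power of \<open>b\<close>.\<close>

definition leads_at :: "int \<Rightarrow> int \<Rightarrow> int \<Rightarrow> torus_vec \<Rightarrow> bool" where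
  "leads_at n i j v \<longleftrightarrow> v n i j = 1 \<and>
    (\<forall>n' i' j'. v n' i' j' \<noteq> 0 \<longrightarrow> n' = n \<and> (i < i' \<or> i' = i \<and> j' = j))"

text \<open>The action of the cluster algebra through the torus. Applied to the vector of the monomial \<open>1\<close>, the
  factors of a monomial of the cluster algebra move the leading exponent one after the other: first \<open>c\<close>
  and \<open>b\<close>, as long as the exponent of \<open>a\<close> is \<open>0\<close> and no power of \<open>t\<close> appears, then \<open>a\<close> or \<open>a*\<close>. The
  operator of \<open>a*\<close> adds a term with higher powers of \<open>b\<close> and \<open>c\<close>, which leaves the leading one alone.\<close>

theorem exists_leading_action:
  fixes \<iota> :: "clu_gen palg \<Rightarrow> tor_gen palg"
  assumes \<iota>: "alg_map \<iota>" "\<And>g. \<iota> (pgen g) = tor_image g"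
  obtains \<sigma> :: "clu_gen palg \<Rightarrow> torus_vec \<Rightarrow> torus_vec" where
    "\<And>x y v. \<sigma> (x + y) v = \<sigma> x v + \<sigma> y v"
    "\<And>r x v. \<sigma> (r \<cdot> x) v = (\<lambda>n i j. r * \<sigma> x v n i j)"
    "\<And>x. \<iota> x = 0 \<Longrightarrow> \<sigma> x = \<sigma> 0"
    "\<And>n i j v. leads_at 0 0 0 v \<Longrightarrow> leads_at n i j (\<sigma> (clu_monomial n i j) v)"
proof -
  obtain \<rho> :: "tor_gen palg \<Rightarrow> torus_vec \<Rightarrow> torus_vec" where \<rho>:
    "\<And>x y v. \<rho> (x + y) v = \<rho> x v + \<rho> y v"
    "\<And>x y v. \<rho> (x * y) v = \<rho> x (\<rho> y v)"
    "\<And>v. \<rho> 1 v = v"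
    "\<And>r x v. \<rho> (r \<cdot> x) v = (\<lambda>n i j. r * \<rho> x v n i j)"
    "\<And>g v. \<rho> (pgen g) v = torus_op g v"
    using exists_action[OF torus_op_action torus_op_relations[folded relations_tor_gen_def]] by blast
  define \<sigma> where "\<sigma> x = \<rho> (\<iota> x)" for x
  note \<sigma> = \<sigma>_def \<rho> alg_mapD[OF \<iota>(1)]
  have mult: "\<sigma> (x * y) v = \<sigma> x (\<sigma> y v)" and one: "\<sigma> 1 v = v" for x y v
    by (simp_all add: \<sigma>)
  have gens: "\<sigma> (pgen Ga) v = torus_op (X Va) v" "\<sigma> (pgen Gb) v = torus_op (X Vb) v"
    "\<sigma> (pgen Gbi) v = torus_op (Xi Vb) v" "\<sigma> (pgen Gc) v = torus_op (X Vc) v"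
    "\<sigma> (pgen Gci) v = torus_op (Xi Vc) v"
    "\<sigma> (pgen Gas) v = (\<lambda>n i j.
      inverse tt * (tt powi (n + 1) * (tt powi (n + 1) * v (n + 1) (i - 1) (j - 1))) + v (n + 1) i j)"
    for v
    by (simp_all add: \<sigma> \<iota>(2) tor_image_def of_free_a_star plus_fun_def)
  have ipow: "P n (\<sigma> (ipow x y n) v)"
    if "P 0 v" "\<And>n v. P n v \<Longrightarrow> P (n + 1) (\<sigma> x v)" "\<And>n v. P n v \<Longrightarrow> P (n - 1) (\<sigma> y v)"
    for P :: "int \<Rightarrow> torus_vec \<Rightarrow> bool" and x y v n
  proof (induction n rule: ipow_induct)
    case (up n)
    then show ?case
      using that(2) by (simp add: mult flip: ipow_step_nonneg)
  next
    case (down n)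
    then show ?case
      using that(3) by (simp add: mult flip: ipow_step_nonpos)
  qed (simp add: one that(1))
  have leads_Gas: "leads_at (n - 1) i j (\<sigma> (pgen Gas) v)" if "leads_at n i j v" for n i j v
  proof -
    have v: "v n i j = 1" "\<And>n' i' j'. v n' i' j' \<noteq> 0 \<Longrightarrow> n' = n \<and> (i < i' \<or> i' = i \<and> j' = j)"
      using that by (auto simp: leads_at_def)
    have "v n (i - 1) (j - 1) = 0"
      using v(2)[of n "i - 1" "j - 1"] by auto
    moreover have "n' = n - 1 \<and> (i < i' \<or> i' = i \<and> j' = j)"
      if "\<sigma> (pgen Gas) v n' i' j' \<noteq> 0" for n' i' j'
    proof -
      have "v (n' + 1) (i' - 1) (j' - 1) \<noteq> 0 \<or> v (n' + 1) i' j' \<noteq> 0"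
        using that by (auto simp: gens)
      then show ?thesis
        using v(2)[of "n' + 1" "i' - 1" "j' - 1"] v(2)[of "n' + 1" i' j'] by auto
    qed
    ultimately show ?thesis
      using v(1) by (simp add: leads_at_def gens)
  qed
  have "leads_at n i j (\<sigma> (clu_monomial n i j) v)" if v: "leads_at 0 0 0 v" for n i j v
  proof -
    have "leads_at 0 0 j (\<sigma> (ipow (pgen Gc) (pgen Gci) j) v)"
      by (rule ipow[where P = "leads_at 0 0", OF v]) (force simp: leads_at_def gens)+
    then have "leads_at 0 i j
        (\<sigma> (ipow (pgen Gb) (pgen Gbi) i) (\<sigma> (ipow (pgen Gc) (pgen Gci) j) v))"
      by (rule ipow[where P = "\<lambda>i. leads_at 0 i j"]) (force simp: leads_at_def gens)+
    then have "leads_at n i j (\<sigma> (ipow (pgen Ga) (pgen Gas) n)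
        (\<sigma> (ipow (pgen Gb) (pgen Gbi) i) (\<sigma> (ipow (pgen Gc) (pgen Gci) j) v)))"
      by (rule ipow[where P = "\<lambda>n. leads_at n i j"])
        (force simp: leads_at_def gens, rule leads_Gas)
    then show ?thesis
      by (simp add: clu_monomial_def mult)
  qed
  then show ?thesis
    by (intro that[of \<sigma>]) (simp_all add: \<sigma>)
qed

text \<open>Monomials with distinct exponents have distinct leading exponents, ordered by the power of \<open>b\<close>; a
  linear combination is therefore detected at a monomial of least power of \<open>b\<close> among those that occur
  with nonzero coefficient.\<close>

theorem inj_torus_embedding:
  fixes \<iota> :: "clu_gen palg \<Rightarrow> tor_gen palg"
  assumes \<iota>: "alg_map \<iota>" "\<And>g. \<iota> (pgen g) = tor_image g"
  shows "inj \<iota>"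
proof -
  obtain \<sigma> :: "clu_gen palg \<Rightarrow> torus_vec \<Rightarrow> torus_vec" where \<sigma>:
    "\<And>x y v. \<sigma> (x + y) v = \<sigma> x v + \<sigma> y v"
    "\<And>r x v. \<sigma> (r \<cdot> x) v = (\<lambda>n i j. r * \<sigma> x v n i j)"
    "\<And>x. \<iota> x = 0 \<Longrightarrow> \<sigma> x = \<sigma> 0"
    "\<And>n i j v. leads_at 0 0 0 v \<Longrightarrow> leads_at n i j (\<sigma> (clu_monomial n i j) v)"
    using exists_leading_action[OF \<iota>] by blast
  define \<delta> :: torus_vec where "\<delta> n i j = (if n = 0 \<and> i = 0 \<and> j = 0 then 1 else 0)" for n i j
  have \<delta>: "leads_at 0 0 0 \<delta>"
    by (auto simp: leads_at_def \<delta>_def split: if_splits)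
  have zero: "\<sigma> 0 v n i j = 0" for v n i j
    using \<sigma>(2)[of 0 0 v] by simp
  have sum: "\<sigma> (\<Sum>m\<in>T. c m \<cdot> m) v n i j = (\<Sum>m\<in>T. c m * \<sigma> m v n i j)" if "finite T" for T c v n i j
    using that by induction (simp_all add: zero \<sigma>(1,2))
  have "x = 0" if "\<iota> x = 0" for x
  proof (rule ccontr)
    assume "x \<noteq> 0"
    obtain T c where T: "finite T" "T \<subseteq> clu_monomials" and x: "x = (\<Sum>m\<in>T. c m \<cdot> m)"
      using clu_monomials_span[of x] unfolding palg.span_explicit by blast
    define T' where "T' = {m \<in> T. c m \<noteq> 0}"
    have "T' \<noteq> {}"
      using \<open>x \<noteq> 0\<close> x by (auto simp: T'_def intro!: sum.neutral)
    have "\<forall>m\<in>T. \<exists>n i j. m = clu_monomial n i j"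
      using T(2) by (auto simp: clu_monomials_def)
    then obtain N I J where idx: "\<And>m. m \<in> T \<Longrightarrow> m = clu_monomial (N m) (I m) (J m)"
      by metis
    obtain l where l: "l \<in> T'" and min: "\<And>m. m \<in> T' \<Longrightarrow> I l \<le> I m"
      using ex_min_if_finite[of "I ` T'"] T(1) \<open>T' \<noteq> {}\<close>
      by (force simp: T'_def not_less)
    have leads: "leads_at (N m) (I m) (J m) (\<sigma> m \<delta>)" if "m \<in> T" for m
      using \<sigma>(4)[OF \<delta>, of "N m" "I m" "J m"] idx[OF that] by simp
    \<comment> \<open>At the leading exponent of \<open>l\<close>, no other monomial contributes: it would need a smaller power
      of \<open>b\<close>, or the same exponent.\<close>
    have "c m * \<sigma> m \<delta> (N l) (I l) (J l) = (if m = l then c l else 0)" if m: "m \<in> T" for m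
    proof (cases "m = l")
      case True
      then show ?thesis
        using leads[OF m] by (simp add: leads_at_def)
    next
      case False
      have "\<sigma> m \<delta> (N l) (I l) (J l) = 0" if "c m \<noteq> 0"
      proof (rule ccontr)
        assume "\<sigma> m \<delta> (N l) (I l) (J l) \<noteq> 0"
        then have "N l = N m \<and> (I m < I l \<or> I l = I m \<and> J l = J m)"
          using leads[OF m] by (simp add: leads_at_def)
        moreover have "I l \<le> I m"
          using min m that by (simp add: T'_def)
        ultimately have "m = l"
          using idx[OF m] idx[of l] l by (simp add: T'_def)
        with False show False ..
      qed
      with False show ?thesis
        by auto
    qed
    then have "\<sigma> x \<delta> (N l) (I l) (J l) = (\<Sum>m\<in>T. if m = l then c l else 0)"
      by (simp add: x sum[OF T(1)])
    also have "\<dots> = c l"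
      using T(1) l by (simp add: T'_def)
    finally show False
      using l \<sigma>(3)[OF that] zero by (simp add: T'_def)
  qed
  from this[of "x - y" for x y] show ?thesis
    by (auto simp: inj_on_def alg_mapD[OF \<iota>(1)])
qed

lemma range_torus_embedding:
  fixes \<iota> :: "clu_gen palg \<Rightarrow> tor_gen palg"
  assumes \<iota>: "alg_map \<iota>" "\<And>g. \<iota> (pgen g) = tor_image g"
  shows "range (\<lambda>x. coset (\<iota> x)) = cluster_subalgebra"
proof -
  let ?H = "range (\<lambda>r. r \<odot>\<^bsub>torus\<^esub> \<one>\<^bsub>torus\<^esub>) \<union> cls torus_rels `
            {gen (X Va), a_star, gen (X Vb), gen (Xi Vb), gen (X Vc), gen (Xi Vc)}"
  have H: "?H = range (\<lambda>r. coset (r \<cdot> 1)) \<union> range (\<lambda>g. coset (tor_image g))"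
  proof -
    have "range (\<lambda>g. coset (tor_image g)) = (\<lambda>g. coset (tor_image g)) ` {Ga, Gas, Gb, Gbi, Gc, Gci}"
      using clu_gen.exhaust by (intro arg_cong[where f = "image _"]) blast
    then show ?thesis
      by (simp add: torus_eq coset_gen(4) coset_simps tor_image_def coset_gen(5)[of a_star])
  qed
  have "coset (\<iota> x) \<in> generate_ring torus ?H" for x
  proof (induction x rule: palg_induct)
    case one
    show ?case
      using generate_ring.one[of torus ?H] by (simp add: alg_mapD[OF \<iota>(1)] torus_eq coset_simps)
  next
    case (gen g)
    show ?case
      unfolding H by (rule generate_ring.incl) (simp add: \<iota>(2))
  next
    case (add x y)
    then show ?case
      using generate_ring.eng_add[OF add] by (simp add: alg_mapD[OF \<iota>(1)] torus_eq coset_simps)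
  next
    case (mult x y)
    then show ?case
      using generate_ring.eng_mult[OF mult] by (simp add: alg_mapD[OF \<iota>(1)] torus_eq coset_simps)
  next
    case (scale r x)
    have "coset (r \<cdot> 1) \<in> generate_ring torus ?H"
      unfolding H by (rule generate_ring.incl) blast
    from generate_ring.eng_mult[OF this scale] show ?case
      by (simp add: alg_mapD[OF \<iota>(1)] torus_eq coset_simps)
  qed
  moreover have "y \<in> range (\<lambda>x. coset (\<iota> x))" if "y \<in> generate_ring torus ?H" for y
    using that
  proof induction
    case one
    show ?case
      by (rule range_eqI[of _ _ 1]) (simp add: alg_mapD[OF \<iota>(1)] torus_eq coset_simps)
  next
    case (incl y)
    then consider r where "y = coset (r \<cdot> 1)" | g where "y = coset (tor_image g)"
      unfolding H by blast
    then show ?case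
    proof cases
      case 1
      then show ?thesis
        by (intro range_eqI[of _ _ "r \<cdot> 1"]) (simp add: alg_mapD[OF \<iota>(1)])
    next
      case 2
      then show ?thesis
        by (intro range_eqI[of _ _ "pgen g"]) (simp add: \<iota>(2))
    qed
  next
    case (a_inv y)
    then obtain x where "y = coset (\<iota> x)"
      by auto
    then show ?case
      by (intro range_eqI[of _ _ "- x"]) (simp add: alg_mapD[OF \<iota>(1)] torus_eq coset_uminus_power_inv)
  next
    case (eng_add y z)
    then obtain x x' where "y = coset (\<iota> x)" "z = coset (\<iota> x')"
      by auto
    then show ?case
      by (intro range_eqI[of _ _ "x + x'"]) (simp add: alg_mapD[OF \<iota>(1)] torus_eq coset_simps)
  next
    case (eng_mult y z)
    then obtain x x' where "y = coset (\<iota> x)" "z = coset (\<iota> x')"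
      by auto
    then show ?case
      by (intro range_eqI[of _ _ "x * x'"]) (simp add: alg_mapD[OF \<iota>(1)] torus_eq coset_simps)
  qed
  ultimately show ?thesis
    unfolding cluster_subalgebra_def by blast
qed

theorem exists_presentation_iso:
  "\<exists>\<iota> \<in> alg_iso A_t quantum_cluster_algebra. presentation_spec \<iota>"
proof -
  obtain \<iota> where \<iota>: "alg_map \<iota>" "\<And>g. \<iota> (pgen g) = tor_image g"
    by (rule exists_alg_map[of tor_image])
      (auto simp: relations_clu_gen_def intro: tor_image_relations)
  have "transport \<iota> \<in> alg_iso A_t quantum_cluster_algebra"
    unfolding quantum_cluster_algebra_def A_t_eq torus_eq range_torus_embedding[OF \<iota>, symmetric]
    by (rule transport_alg_iso_range[OF \<iota>(1) inj_torus_embedding[OF \<iota>]])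
  moreover have "presentation_spec (transport \<iota>)"
    unfolding presentation_spec_def coset_gen(3,4) coset_gen(5)[of a_star]
    by (simp add: \<iota>(2) tor_image_def)
  ultimately show ?thesis
    by blast
qed

section \<open>The oscillator algebra is a quantum cluster algebra\<close>

theorem theorem6p4:
  "zz \<in> carrier A_t \<and> (\<forall>x \<in> carrier A_t. zz \<otimes>\<^bsub>A_t\<^esub> x = x \<otimes>\<^bsub>A_t\<^esub> zz)
   \<and> (\<exists>\<phi> \<in> alg_iso U_loc A_t. phi_spec \<phi>
        \<and> (\<forall>\<psi> \<in> alg_hom U_loc A_t. phi_spec \<psi> \<longrightarrow> (\<forall>x \<in> carrier U_loc. \<psi> x = \<phi> x)))
   \<and> (\<exists>\<iota> \<in> alg_iso A_t quantum_cluster_algebra. presentation_spec \<iota>)"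
proof (intro conjI)
  show "zz \<in> carrier A_t" "\<forall>x \<in> carrier A_t. zz \<otimes>\<^bsub>A_t\<^esub> x = x \<otimes>\<^bsub>A_t\<^esub> zz"
    by (auto simp: A_t_eq zz_eq carrier_presented_alg coset_simps z_A_central)
qed (rule exists_unique_phi exists_presentation_iso)+

end
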